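(* Let $F$ be a real Hilbert space whose elements are equivalence classes of functions $D\to\mathbb{R}$ (for instance $F=L_2(D)$), let $G$ be a real Hilbert space, and let $S:F\to G$ be a compact linear operator. Then for all $n\in\mathbb{N}=\{1,2,\dots\}$, $$e_n^{\rm std\text{-}ran}(S)\ge\tfrac12\,e_{4n-1}^{\rm all\text{-}wor}(S),$$ where $e_n^{\rm std\text{-}ran}(S)$ is defined with respect to the space $\widetilde V_{n+k}$ of everywhere defined functions described in the context, for any $k\ge3n$ and any choice of representatives $\tilde e_i\in e_i$, $i=1,\dots,n+k$.
   Context: Minimal worst case errors for continuous linear functionals. Let $\Lambda^{\rm all}$ be the class of all continuous linear functionals $F\to\mathbb{R}$. For an integer $m\ge0$, a deterministic algorithm $A_m:F\to G$ using $m$ functionals from $\Lambda^{\rm all}$ is a mapping $A_m(f)=\phi_m(y_1,\dots,y_m)$ with $y_j=L_j(f;y_1,\dots,y_{j-1})$, where $\phi_m:\mathbb{R}^m\to G$ is arbitrary and $L_j(\cdot\,;y_1,\dots,y_{j-1})\in\Lambda^{\rm all}$ for all $j$ and all $y_1,\dots,y_{j-1}\in\mathbb{R}$ (adaptive choice allowed). Its error is $e(A_m)=\sup_{\|f\|_F<1}\|S(f)-A_m(f)\|_G$, and $e_m^{\rm all\text{-}wor}(S)$ is the infimum of $e(A_m)$ over all such algorithms. The space $\widetilde V_{n+k}$. Let $\sigma_1\ge\sigma_2\ge\dots\ge0$ be the singular values of $S$ (with multiplicity, $\lim_i\sigma_i=0$) and $(e_i)$ a corresponding orthonormal system in $F$,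 so that $S^*Sf=\sum_i\sigma_i^2\langle f,e_i\rangle e_i$ for all $f\in F$ and $S(e_i)=\sigma_ie_i'$ with orthonormal $e_i'$ in $G$ (for $\sigma_i>0$). For each $i=1,\dots,n+k$ choose a function $\tilde e_i:D\to\mathbb{R}$ in the equivalence class $e_i$, and let $\widetilde V_{n+k}={\rm span}(\tilde e_1,\dots,\tilde e_{n+k})$; this is a space of functions defined everywhere on $D$. (If $\dim F<n+k$, use all available $e_i$, which then span $F$.) Each $\tilde f=\sum_i\alpha_i\tilde e_i\in\widetilde V_{n+k}$ represents the element $f=\sum_i\alpha_ie_i\in F$; put $\|\tilde f\|=\|f\|_F$ and $S(\tilde f)=S(f)$. Minimal randomized errors for function values. A randomized algorithm $A$ on $\widetilde V_{n+k}$ using function values consists of a probability space $(\Omega,\Sigma,\mu)$ and a family $(N_\omega,\phi_\omega)_{\omega\in\Omega}$ such that: (1) for each fixed $\omega$, $\phi_\omega\circ N_\omega:\widetilde V_{n+k}\to G$ is a deterministic algorithm based on adaptive information $N_\omega$ consisting of function values $\tilde f\mapsto\tilde f(x)$, $x\in D$ (the number of function values used may also vary with $\tilde f$, being determined adaptively from the computed values); (2) if $n(\tilde f,\omega)$ denotes the number of function values used by $N_\omega$ for $\tilde f$, then the function $n$ is measurable; (3) the mapping $(\tilde f,\omega)\mapsto\phi_\omega(N_\omega(\tilde f))\in G$ is measurable. Measurability is with respect to the Borel $\sigma$-fields on $\widetilde V_{n+k}$ and $G$ and the $\sigma$-field $\Sigma$ on $\Omega$. With all suprema over $\tilde f\in\widetilde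 V_{n+k}$ with $\|\tilde f\|<1$, put $$n(A)=\sup_{\tilde f}\int_\Omega n(\tilde f,\omega)\,d\mu(\omega),\qquad e^{\rm ran}(A)=\sup_{\tilde f}\left(\int_\Omega\|S(\tilde f)-\phi_\omega(N_\omega(\tilde f))\|_G^2\,d\mu(\omega)\right)^{1/2},$$ and $e_n^{\rm std\text{-}ran}(S)=\inf\{e^{\rm ran}(A): n(A)\le n\}$, the infimum being over all such randomized algorithms. *)

theory Defs
  imports "HOL-Probability.Probability"
begin

section \<open>Hilbert spaces of classes of functions, compact operators, singular systems\<close>

text \<open>
  The elements of the space \<open>'f\<close> are identified, through \<open>cls\<close>, with the classes of a partition of
  some set of functions on \<open>'d\<close>; the vector space operations are the pointwise ones on
  representatives.  (Equivalently, \<open>'f\<close> is the quotient of a linear space of functions by a linear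
  subspace.)
\<close>

definition function_classes :: "('f::real_vector \<Rightarrow> ('d \<Rightarrow> real) set) \<Rightarrow> bool" where
  "function_classes cls \<longleftrightarrow>
     (\<forall>f. cls f \<noteq> {}) \<and>
     (\<forall>f g. f \<noteq> g \<longrightarrow> cls f \<inter> cls g = {}) \<and>
     (\<forall>f g. \<forall>u\<in>cls f. \<forall>v\<in>cls g. (\<lambda>x. u x + v x) \<in> cls (f + g)) \<and>
     (\<forall>c f. \<forall>u\<in>cls f. (\<lambda>x. c * u x) \<in> cls (c *\<^sub>R f))"

definition compact_operator :: "('a::real_normed_vector \<Rightarrow> 'b::real_normed_vector) \<Rightarrow> bool" where
  "compact_operator S \<longleftrightarrow> bounded_linear S \<and> (\<forall>B. bounded B \<longrightarrow> compact (closure (S ` B)))"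

text \<open>
  Indices start at 1; \<open>\<sigma> 0\<close> and \<open>e 0\<close> are irrelevant.  The set \<open>I\<close> of available indices is
  \<open>{1..}\<close> if the domain is infinite dimensional and \<open>{1..dim}\<close> otherwise: orthonormality
  excludes \<open>{1..}\<close> in finite dimension, and the spanning condition excludes \<open>{1..N}\<close> in
  infinite dimension.  Singular values beyond the dimension are 0.  The \<open>e i\<close> with \<open>\<sigma> i = 0\<close> are
  eigenvectors of \<open>S* S\<close> too, but the \<open>e i\<close> need not be complete when \<open>I = {1..}\<close>.
\<close>

definition singular_system ::
  "('f::real_inner \<Rightarrow> 'g::real_inner) \<Rightarrow> nat set \<Rightarrow> (nat \<Rightarrow> real) \<Rightarrow> (nat \<Rightarrow> 'f) \<Rightarrow> bool" where
  "singular_system S I \<sigma> e \<longleftrightarrow>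
     (I = {1..} \<or> (\<exists>N. I = {1..N} \<and> span (e ` I) = UNIV)) \<and>
     (\<forall>i\<in>I. \<forall>j\<in>I. e i \<bullet> e j = (if i = j then 1 else 0)) \<and>
     (\<forall>i\<ge>1. 0 \<le> \<sigma> i) \<and> (\<forall>i\<ge>1. \<forall>j\<ge>i. \<sigma> j \<le> \<sigma> i) \<and> \<sigma> \<longlonglongrightarrow> 0 \<and>
     (\<forall>i\<ge>1. i \<notin> I \<longrightarrow> \<sigma> i = 0) \<and>
     (\<forall>f. ((\<lambda>i. (\<sigma> i)\<^sup>2 *\<^sub>R ((f \<bullet> e i) *\<^sub>R e i)) has_sum adjoint S (S f)) I)"


section \<open>Worst case error for arbitrary continuous linear functionals\<close>

text \<open>
  \<open>L ys\<close> is the functional applied after the values \<open>ys\<close> have been computed, so that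
  \<open>y\<^sub>j = L [y\<^sub>1, \<dots>, y\<^sub>j\<^sub>-\<^sub>1] f\<close>.
\<close>

primrec all_info :: "(real list \<Rightarrow> 'f \<Rightarrow> real) \<Rightarrow> 'f \<Rightarrow> nat \<Rightarrow> real list" where
  "all_info L f 0 = []"
| "all_info L f (Suc j) = all_info L f j @ [L (all_info L f j) f]"

definition all_admissible :: "nat \<Rightarrow> (real list \<Rightarrow> 'f::real_normed_vector \<Rightarrow> real) \<Rightarrow> bool" where
  "all_admissible m L \<longleftrightarrow> (\<forall>ys. length ys < m \<longrightarrow> bounded_linear (L ys))"

definition wor_error ::
  "('f::real_normed_vector \<Rightarrow> 'g::real_normed_vector) \<Rightarrow> ('f \<Rightarrow> 'g) \<Rightarrow> ennreal" where
  "wor_error S A = (SUP f\<in>{f. norm f < 1}. ennreal (norm (S f - A f)))"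

definition e_all_wor ::
  "('f::real_normed_vector \<Rightarrow> 'g::real_normed_vector) \<Rightarrow> nat \<Rightarrow> ennreal" where
  "e_all_wor S m =
     (INF (L, \<phi>) \<in> {(L, \<phi> :: real list \<Rightarrow> 'g). all_admissible m L}.
        wor_error S (\<lambda>f. \<phi> (all_info L f m)))"


section \<open>The space of everywhere defined functions\<close>

definition V_space :: "nat set \<Rightarrow> (nat \<Rightarrow> 'd \<Rightarrow> real) \<Rightarrow> ('d \<Rightarrow> real) set" where
  "V_space J et = {\<lambda>x. \<Sum>i\<in>J. \<alpha> i * et i x |\<alpha>. True}"

text \<open>
  The element of the Hilbert space represented by a function in \<open>V_space J et\<close>.  It is unique when
  \<open>et i \<in> cls (e i)\<close> for all \<open>i \<in> J\<close>, since the \<open>et i\<close> are then linearly independent whenever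
  the \<open>e i\<close> are.
\<close>

definition elem :: "nat set \<Rightarrow> (nat \<Rightarrow> 'f::real_vector) \<Rightarrow> (nat \<Rightarrow> 'd \<Rightarrow> real) \<Rightarrow> ('d \<Rightarrow> real) \<Rightarrow> 'f" where
  "elem J e et u =
     (THE f. \<exists>\<alpha>. u = (\<lambda>x. \<Sum>i\<in>J. \<alpha> i * et i x) \<and> f = (\<Sum>i\<in>J. \<alpha> i *\<^sub>R e i))"

definition V_dist ::
  "nat set \<Rightarrow> (nat \<Rightarrow> 'f::real_normed_vector) \<Rightarrow> (nat \<Rightarrow> 'd \<Rightarrow> real) \<Rightarrow>
     ('d \<Rightarrow> real) \<Rightarrow> ('d \<Rightarrow> real) \<Rightarrow> real" where
  "V_dist J e et u v = norm (elem J e et (\<lambda>x. u x - v x))"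

definition V_borel ::
  "nat set \<Rightarrow> (nat \<Rightarrow> 'f::real_normed_vector) \<Rightarrow> (nat \<Rightarrow> 'd \<Rightarrow> real) \<Rightarrow> ('d \<Rightarrow> real) measure" where
  "V_borel J e et =
     sigma (V_space J et)
       {U. openin (Metric_space.mtopology (V_space J et) (V_dist J e et)) U}"

definition V_ball ::
  "nat set \<Rightarrow> (nat \<Rightarrow> 'f::real_normed_vector) \<Rightarrow> (nat \<Rightarrow> 'd \<Rightarrow> real) \<Rightarrow> ('d \<Rightarrow> real) set" where
  "V_ball J e et = {u \<in> V_space J et. norm (elem J e et u) < 1}"


section \<open>Randomized error for function values\<close>

text \<open>
  Adaptive information of varying cardinality: given the values \<open>ys\<close> computed so far, \<open>q ys\<close> is
  either the next sampling point or \<open>None\<close>, in which case the sampling stops.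
\<close>

primrec values_upto :: "(real list \<Rightarrow> 'd option) \<Rightarrow> ('d \<Rightarrow> real) \<Rightarrow> nat \<Rightarrow> real list" where
  "values_upto q u 0 = []"
| "values_upto q u (Suc j) =
     (case q (values_upto q u j) of
        None \<Rightarrow> values_upto q u j
      | Some x \<Rightarrow> values_upto q u j @ [u x])"

definition terminates :: "(real list \<Rightarrow> 'd option) \<Rightarrow> ('d \<Rightarrow> real) \<Rightarrow> bool" where
  "terminates q u \<longleftrightarrow> (\<exists>j. q (values_upto q u j) = None)"

definition num_values :: "(real list \<Rightarrow> 'd option) \<Rightarrow> ('d \<Rightarrow> real) \<Rightarrow> nat" where
  "num_values q u = (LEAST j. q (values_upto q u j) = None)"

definition std_info :: "(real list \<Rightarrow> 'd option) \<Rightarrow> ('d \<Rightarrow> real) \<Rightarrow> real list" where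
  "std_info q u = values_upto q u (num_values q u)"

definition randomized_algorithm ::
  "nat set \<Rightarrow> (nat \<Rightarrow> 'f::real_normed_vector) \<Rightarrow> (nat \<Rightarrow> 'd \<Rightarrow> real) \<Rightarrow> 'w measure \<Rightarrow>
     ('w \<Rightarrow> real list \<Rightarrow> 'd option) \<Rightarrow> ('w \<Rightarrow> real list \<Rightarrow> 'g::real_normed_vector) \<Rightarrow> bool" where
  "randomized_algorithm J e et M q \<phi> \<longleftrightarrow>
     prob_space M \<and>
     (\<forall>\<omega>\<in>space M. \<forall>u\<in>V_space J et. terminates (q \<omega>) u) \<and>
     (\<lambda>(u, \<omega>). num_values (q \<omega>) u) \<in> V_borel J e et \<Otimes>\<^sub>M M \<rightarrow>\<^sub>M count_space UNIV \<and>
     (\<lambda>(u, \<omega>). \<phi> \<omega> (std_info (q \<omega>) u)) \<in> V_borel J e et \<Otimes>\<^sub>M M \<rightarrow>\<^sub>M borel"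

definition ran_cost ::
  "nat set \<Rightarrow> (nat \<Rightarrow> 'f::real_normed_vector) \<Rightarrow> (nat \<Rightarrow> 'd \<Rightarrow> real) \<Rightarrow> 'w measure \<Rightarrow>
     ('w \<Rightarrow> real list \<Rightarrow> 'd option) \<Rightarrow> ennreal" where
  "ran_cost J e et M q =
     (SUP u\<in>V_ball J e et. \<integral>\<^sup>+\<omega>. of_nat (num_values (q \<omega>) u) \<partial>M)"

definition ennreal_sqrt :: "ennreal \<Rightarrow> ennreal" where
  "ennreal_sqrt x = (if x = \<infinity> then \<infinity> else ennreal (sqrt (enn2real x)))"

definition ran_error ::
  "('f::real_normed_vector \<Rightarrow> 'g::real_normed_vector) \<Rightarrow>
     nat set \<Rightarrow> (nat \<Rightarrow> 'f) \<Rightarrow> (nat \<Rightarrow> 'd \<Rightarrow> real) \<Rightarrow> 'w measure \<Rightarrow>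
     ('w \<Rightarrow> real list \<Rightarrow> 'd option) \<Rightarrow> ('w \<Rightarrow> real list \<Rightarrow> 'g) \<Rightarrow> ennreal" where
  "ran_error S J e et M q \<phi> =
     (SUP u\<in>V_ball J e et. ennreal_sqrt
        (\<integral>\<^sup>+\<omega>. ennreal ((norm (S (elem J e et u) - \<phi> \<omega> (std_info (q \<omega>) u)))\<^sup>2) \<partial>M))"

text \<open>
  The infimum over all randomized algorithms whose probability space lives on the type \<open>'w\<close>.  A
  lower bound stated for an arbitrary type \<open>'w\<close> is a lower bound for the infimum over all
  probability spaces.
\<close>

definition e_std_ran ::
  "'w itself \<Rightarrow> ('f::real_normed_vector \<Rightarrow> 'g::real_normed_vector) \<Rightarrow>
     nat set \<Rightarrow> (nat \<Rightarrow> 'f) \<Rightarrow> (nat \<Rightarrow> 'd \<Rightarrow> real) \<Rightarrow> nat \<Rightarrow> ennreal" where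
  "e_std_ran _ S J e et n =
     (INF (M, q, \<phi>) \<in> {(M :: 'w measure, q, \<phi>).
          randomized_algorithm J e et M q \<phi> \<and> ran_cost J e et M q \<le> of_nat n}.
        ran_error S J e et M q \<phi>)"

end

theory Submission
  imports Defs
begin

text \<open>
  The linear algorithm that truncates the singular value expansion shows that
  \<open>e_all_wor S (4 n - 1) \<le> \<sigma> (4 n)\<close>.  For the lower bound \<open>\<sigma> (4 n) / 2\<close> on the
  randomized error, average over \<open>u = z\<^sub>1 e\<^sub>1 + \<dots> + z\<^sub>N e\<^sub>N\<close>, \<open>N = 4 n\<close>, with \<open>z\<close> uniform in
  the shell \<open>3/4 \<le> |z|\<^sup>2 < 1\<close>.  Function values are linear functionals of \<open>z\<close>, and the distribution
  is rotation invariant, so every value reveals one coordinate of a rotated \<open>z\<close>; the error is at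
  least \<open>\<sigma> N\<close> times the norm of the coordinates left.  Induction on the number \<open>d\<close> of coordinates
  left, with \<open>d / N\<close> times their squared norm as value function, shows that for every deterministic
  algorithm with squared error \<open>E\<close> and cost \<open>C\<close> the mean of \<open>E + (2 / N) (\<sigma> N)\<^sup>2 C\<close> is at least
  \<open>(\<sigma> N)\<^sup>2\<close> times the mean of \<open>|z|\<^sup>2\<close>.  As the mean cost is at most \<open>n\<close>, the mean squared error is
  at least \<open>(3/4 - 1/2) (\<sigma> N)\<^sup>2\<close>.
\<close>

section \<open>Rotation invariance of Lebesgue measure\<close>

abbreviation Leb :: "nat set \<Rightarrow> (nat \<Rightarrow> real) measure" where
  "Leb K \<equiv> Pi\<^sub>M K (\<lambda>_. lborel)"

interpretation Leb: product_sigma_finite "\<lambda>_::nat. lborel :: real measure"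
  by standard

lemma measurable_fun_upd_Leb:
  assumes "i \<in> K" "g \<in> borel_measurable (Leb K)"
  shows "(\<lambda>z. z(i := g z)) \<in> Leb K \<rightarrow>\<^sub>M Leb K"
  using assms by (intro measurable_fun_upd[where J=K]) (auto simp: insert_absorb)

text \<open>By Fubini the \<open>i\<close>-th variable can be integrated innermost. There
  \<open>h\<close> is constant, so the substitution is affine with slope of modulus 1. Shears are
  the case \<open>a = 1\<close>, reflections the case \<open>a = -1\<close>.\<close>

lemma nn_integral_Leb_coordinate:
  assumes K: "finite K" "i \<in> K" and F: "F \<in> borel_measurable (Leb K)"
    and h: "h \<in> borel_measurable (Leb K)" "\<And>z y. h (z(i := y)) = h z" and a: "\<bar>a\<bar> = (1::real)"
  shows "(\<integral>\<^sup>+z. F (z(i := a * z i + h z)) \<partial>Leb K) = (\<integral>\<^sup>+z. F z \<partial>Leb K)"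
proof -
  define K' where "K' = K - {i}"
  have KK: "K = insert i K'" "i \<notin> K'" "finite K'" using K by (auto simp: K'_def)
  have m: "(\<lambda>z. a * z i + h z) \<in> borel_measurable (Leb K)"
    using h(1) K by measurable
  have F': "(\<lambda>z. F (z(i := a * z i + h z))) \<in> borel_measurable (Leb (insert i K'))"
    using measurable_compose[OF measurable_fun_upd_Leb[OF K(2) m] F] by (simp add: KK)
  have inner: "(\<integral>\<^sup>+y. F (x(i := a * y + h x)) \<partial>lborel) = (\<integral>\<^sup>+y. F (x(i := y)) \<partial>lborel)"
    if x: "x \<in> space (Leb K')" for x
  proof -
    have "(\<lambda>y. F (x(i := y))) \<in> borel_measurable borel"
    proof (rule measurable_compose[OF _ F])
      have "(\<lambda>y. x(i := y)) \<in> lborel \<rightarrow>\<^sub>M Leb K"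
        unfolding KK using x by (intro measurable_component_update) (auto simp: KK)
      then show "(\<lambda>y. x(i := y)) \<in> borel \<rightarrow>\<^sub>M Leb K" by simp
    qed
    from nn_integral_real_affine[OF this, of a "h x"] a show ?thesis
      by (simp add: add.commute)
  qed
  show ?thesis
    unfolding KK(1) Leb.product_nn_integral_insert[OF KK(3,2) F']
      Leb.product_nn_integral_insert[OF KK(3,2) F[unfolded KK(1)]]
    by (rule nn_integral_cong) (simp add: h inner)
qed

section \<open>Orthogonal maps of the coordinates and plane rotations\<close>

definition sqnorm :: "nat set \<Rightarrow> (nat \<Rightarrow> real) \<Rightarrow> real" where
  "sqnorm K z = (\<Sum>k\<in>K. (z k)\<^sup>2)"

lemma sqnorm_nonneg: "0 \<le> sqnorm K z"
  by (simp add: sqnorm_def sum_nonneg)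

lemma measurable_sqnorm [measurable]: "X \<subseteq> K \<Longrightarrow> sqnorm X \<in> borel_measurable (Leb K)"
  unfolding sqnorm_def[abs_def] by (intro borel_measurable_sum borel_measurable_power) auto

text \<open>This stands for an orthogonal map of the coordinates in \<open>K\<close>. It is encoded
  by its consequences for integrals, distances and linear functionals instead of a matrix, so that
  closure under composition is direct.\<close>

definition Leb_isometry :: "nat set \<Rightarrow> ((nat \<Rightarrow> real) \<Rightarrow> nat \<Rightarrow> real) \<Rightarrow> bool" where
  "Leb_isometry K R \<longleftrightarrow>
     R \<in> Leb K \<rightarrow>\<^sub>M Leb K \<and>
     (\<forall>F\<in>borel_measurable (Leb K). (\<integral>\<^sup>+z. F (R z) \<partial>Leb K) = (\<integral>\<^sup>+z. F z \<partial>Leb K)) \<and>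
     (\<forall>z z'. (\<Sum>k\<in>K. (R z k - R z' k)\<^sup>2) = (\<Sum>k\<in>K. (z k - z' k)\<^sup>2)) \<and>
     (\<forall>z. sqnorm K (R z) = sqnorm K z) \<and>
     (\<forall>\<beta>. \<exists>\<beta>'. \<forall>z. (\<Sum>k\<in>K. \<beta> k * R z k) = (\<Sum>k\<in>K. \<beta>' k * z k))"

lemma Leb_isometry_nn_integral:
  "Leb_isometry K R \<Longrightarrow> F \<in> borel_measurable (Leb K) \<Longrightarrow>
    (\<integral>\<^sup>+z. F (R z) \<partial>Leb K) = (\<integral>\<^sup>+z. F z \<partial>Leb K)"
  unfolding Leb_isometry_def by blast

lemma Leb_isometry_id: "Leb_isometry K (\<lambda>z. z)"
  unfolding Leb_isometry_def by auto

lemma Leb_isometry_comp: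
  assumes "Leb_isometry K R" "Leb_isometry K R'"
  shows "Leb_isometry K (\<lambda>z. R (R' z))"
proof -
  have m: "R \<in> Leb K \<rightarrow>\<^sub>M Leb K" "R' \<in> Leb K \<rightarrow>\<^sub>M Leb K"
    using assms by (auto simp: Leb_isometry_def)
  have i: "(\<integral>\<^sup>+z. F (R (R' z)) \<partial>Leb K) = (\<integral>\<^sup>+z. F z \<partial>Leb K)"
    if F: "F \<in> borel_measurable (Leb K)" for F
    using assms F measurable_compose[OF m(1) F] by (auto simp: Leb_isometry_def)
  have l: "\<exists>\<beta>'. \<forall>z. (\<Sum>k\<in>K. \<beta> k * R (R' z) k) = (\<Sum>k\<in>K. \<beta>' k * z k)" for \<beta>
  proof -
    obtain \<beta>1 where 1: "\<And>z. (\<Sum>k\<in>K. \<beta> k * R z k) = (\<Sum>k\<in>K. \<beta>1 k * z k)"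
      using assms(1) unfolding Leb_isometry_def by metis
    obtain \<beta>2 where "\<And>z. (\<Sum>k\<in>K. \<beta>1 k * R' z k) = (\<Sum>k\<in>K. \<beta>2 k * z k)"
      using assms(2) unfolding Leb_isometry_def by metis
    with 1 show ?thesis by auto
  qed
  show ?thesis
    using assms measurable_compose[OF m(2) m(1)] i l by (simp add: Leb_isometry_def)
qed

definition givens :: "nat \<Rightarrow> nat \<Rightarrow> real \<Rightarrow> real \<Rightarrow> (nat \<Rightarrow> real) \<Rightarrow> nat \<Rightarrow> real" where
  "givens i j c s z = z(i := c * z i - s * z j, j := s * z i + c * z j)"

lemma sum_two:
  fixes f :: "nat \<Rightarrow> real"
  assumes "finite K" "i \<in> K" "j \<in> K" "i \<noteq> j"
  shows "(\<Sum>k\<in>K. f k) = f i + f j + (\<Sum>k\<in>K - {i, j}. f k)"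
proof -
  have "K - {i} - {j} = K - {i, j}" by blast
  then show ?thesis
    using assms sum.remove[of K i f] sum.remove[of "K - {i}" j f] by simp
qed

text \<open>A rotation of the argument acts on the coefficients of a functional as the transposed
  rotation.\<close>

lemma sum_givens:
  assumes "finite K" "i \<in> K" "j \<in> K" "i \<noteq> j"
  shows "(\<Sum>k\<in>K. \<beta> k * givens i j c s z k) =
    (\<Sum>k\<in>K. (\<beta>(i := c * \<beta> i + s * \<beta> j, j := c * \<beta> j - s * \<beta> i)) k * z k)"
  unfolding sum_two[OF assms] givens_def using assms
  by (simp add: algebra_simps)

lemma Leb_isometry_givens:
  assumes K: "finite K" "i \<in> K" "j \<in> K" "i \<noteq> j" and cs: "c\<^sup>2 + s\<^sup>2 = 1" "s \<noteq> 0"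
  shows "Leb_isometry K (givens i j c s)"
proof -
  \<comment> \<open>A rotation of the plane is a product of three shears.\<close>
  define t where "t = (c - 1) / s"
  define A where "A = (\<lambda>z::nat \<Rightarrow> real. z(i := 1 * z i + t * z j))"
  define B where "B = (\<lambda>z::nat \<Rightarrow> real. z(j := 1 * z j + s * z i))"
  \<comment> \<open>\<open>t\<close> is minus the tangent of half the angle. The two identities are
    the diagonal and the off-diagonal entry that make the product \<open>A\<close>,
    \<open>B\<close>, \<open>A\<close> of shears equal to the rotation.\<close>
  have ts: "1 + t * s = c" "t * (1 + c) = - s"
    using cs by (auto simp: t_def field_simps power2_eq_square)
  have G: "givens i j c s z = A (B (A z))" for z
  proof -
    have "c * z i - s * z j = (1 + t * s) * z i + (t + t * (1 + t * s)) * z j"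
      using ts by (simp add: algebra_simps)
    moreover have "s * z i + c * z j = s * z i + (1 + t * s) * z j" using ts by simp
    ultimately show ?thesis
      using K by (auto simp: givens_def A_def B_def fun_eq_iff algebra_simps)
  qed
  have mA: "A \<in> Leb K \<rightarrow>\<^sub>M Leb K" and mB: "B \<in> Leb K \<rightarrow>\<^sub>M Leb K"
    unfolding A_def B_def using K by (intro measurable_fun_upd_Leb; measurable)+
  have iA: "(\<integral>\<^sup>+z. F (A z) \<partial>Leb K) = (\<integral>\<^sup>+z. F z \<partial>Leb K)"
    and iB: "(\<integral>\<^sup>+z. F (B z) \<partial>Leb K) = (\<integral>\<^sup>+z. F z \<partial>Leb K)"
    if "F \<in> borel_measurable (Leb K)" for F
    unfolding A_def B_def using K that
    by (intro nn_integral_Leb_coordinate; (measurable | simp))+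
  have "(\<integral>\<^sup>+z. F (givens i j c s z) \<partial>Leb K) = (\<integral>\<^sup>+z. F z \<partial>Leb K)"
    if F: "F \<in> borel_measurable (Leb K)" for F
    using iA[OF measurable_compose[OF mB measurable_compose[OF mA F]]]
      iB[OF measurable_compose[OF mA F]] iA[OF F] by (simp add: G)
  moreover have "givens i j c s \<in> Leb K \<rightarrow>\<^sub>M Leb K"
    unfolding G[abs_def] by (intro measurable_compose[OF mA] measurable_compose[OF mB] mA)
  moreover have rot: "(c * x - s * y)\<^sup>2 + (s * x + c * y)\<^sup>2 = x\<^sup>2 + y\<^sup>2" for x y
  proof -
    have "(c * x - s * y)\<^sup>2 + (s * x + c * y)\<^sup>2 = (c\<^sup>2 + s\<^sup>2) * (x\<^sup>2 + y\<^sup>2)"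
      by (simp add: power2_eq_square algebra_simps)
    then show ?thesis using cs by simp
  qed
  moreover have "(\<Sum>k\<in>K. (givens i j c s z k - givens i j c s z' k)\<^sup>2) = (\<Sum>k\<in>K. (z k - z' k)\<^sup>2)"
    for z z'
    using rot[of "z i - z' i" "z j - z' j"] K
    unfolding sum_two[OF K] by (simp add: givens_def algebra_simps)
  moreover have "sqnorm K (givens i j c s z) = sqnorm K z" for z
    using rot[of "z i" "z j"] K
    unfolding sum_two[OF K] sqnorm_def by (simp add: givens_def)
  ultimately show ?thesis
    unfolding Leb_isometry_def using sum_givens[OF K, of _ c s] by blast
qed

text \<open>Each plane rotation kills one nonzero coefficient, so the induction runs over their
  number. This is what turns an arbitrary function value into the observation of one
  coordinate.\<close>

lemma rotate_functional_to_coordinate: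
  assumes K: "finite K" "K \<noteq> {}"
  shows "\<exists>R i \<gamma>. Leb_isometry K R \<and> i \<in> K \<and> (\<forall>z. (\<Sum>k\<in>K. \<beta> k * R z k) = \<gamma> * z i)"
proof (induction "card {k\<in>K. \<beta> k \<noteq> 0}" arbitrary: \<beta> rule: less_induct)
  case less
  show ?case
  proof (cases "\<exists>i\<in>K. \<exists>j\<in>K. i \<noteq> j \<and> \<beta> i \<noteq> 0 \<and> \<beta> j \<noteq> 0")
    case False
    \<comment> \<open>At most one coefficient is nonzero. If all vanish,
      \<open>K \<noteq> {}\<close> still supplies some \<open>i\<close>, and the factor
      \<open>\<gamma>\<close> is 0.\<close>
    obtain i where i: "i \<in> K" "\<And>j. j \<in> K \<Longrightarrow> j \<noteq> i \<Longrightarrow> \<beta> j = 0"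
      using False K(2) by blast
    have "(\<Sum>k\<in>K. \<beta> k * z k) = \<beta> i * z i" for z
      using i K by (subst sum.remove[of K i]) (auto intro!: sum.neutral)
    with i show ?thesis
      using Leb_isometry_id by blast
  next
    case True
    then obtain i j where ij: "i \<in> K" "j \<in> K" "i \<noteq> j" "\<beta> i \<noteq> 0" "\<beta> j \<noteq> 0" by blast
    define r where "r = sqrt ((\<beta> i)\<^sup>2 + (\<beta> j)\<^sup>2)"
    have r2: "r\<^sup>2 = (\<beta> i)\<^sup>2 + (\<beta> j)\<^sup>2" by (simp add: r_def)
    have r: "r > 0" unfolding r_def using ij by (simp add: add_pos_pos)
    \<comment> \<open>With this angle the transposed rotation sends the pair
      \<open>(\<beta> i, \<beta> j)\<close> to \<open>(r, 0)\<close>: index \<open>j\<close> leaves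
      the support and no index enters it.\<close>
    define c where "c = \<beta> i / r"
    define s where "s = \<beta> j / r"
    have G: "Leb_isometry K (givens i j c s)"
    proof (rule Leb_isometry_givens)
      have "c\<^sup>2 + s\<^sup>2 = ((\<beta> i)\<^sup>2 + (\<beta> j)\<^sup>2) / r\<^sup>2"
        by (simp add: c_def s_def power_divide add_divide_distrib)
      then show "c\<^sup>2 + s\<^sup>2 = 1" unfolding r2[symmetric] using r by simp
      show "s \<noteq> 0" using r ij by (simp add: s_def)
    qed (use K ij in auto)
    define \<beta>' where "\<beta>' = \<beta>(i := c * \<beta> i + s * \<beta> j, j := c * \<beta> j - s * \<beta> i)"
    have "\<beta>' j = 0" by (simp add: \<beta>'_def c_def s_def)
    then have "{k\<in>K. \<beta>' k \<noteq> 0} \<subset> {k\<in>K. \<beta> k \<noteq> 0}"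
      using ij by (auto simp: \<beta>'_def)
    then have "card {k\<in>K. \<beta>' k \<noteq> 0} < card {k\<in>K. \<beta> k \<noteq> 0}"
      using K by (intro psubset_card_mono) auto
    from less[OF this] obtain R l \<gamma> where R: "Leb_isometry K R" "l \<in> K"
      "\<And>z. (\<Sum>k\<in>K. \<beta>' k * R z k) = \<gamma> * z l" by blast
    have "(\<Sum>k\<in>K. \<beta> k * givens i j c s (R z) k) = \<gamma> * z l" for z
      unfolding sum_givens[OF K(1) ij(1,2,3)] using R(3) by (simp add: \<beta>'_def)
    with Leb_isometry_comp[OF G R(1)] R(2) show ?thesis by blast
  qed
qed

text \<open>Coordinates are reflected one at a time. Measurability is proved in the same induction
  because the substitution in the next coordinate requires it. For \<open>A = K\<close> this is the
  symmetry under negation.\<close>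

lemma nn_integral_Leb_uminus:
  assumes K: "finite K" and F: "F \<in> borel_measurable (Leb K)" and A: "finite A" "A \<subseteq> K"
  shows "(\<integral>\<^sup>+z. F (\<lambda>k. if k \<in> A then - z k else z k) \<partial>Leb K) = (\<integral>\<^sup>+z. F z \<partial>Leb K)"
    and "(\<lambda>z k. if k \<in> A then - z k else z k) \<in> Leb K \<rightarrow>\<^sub>M Leb K"
  using A
proof (induction A)
  case empty
  { case 1 show ?case by simp }
  { case 2 show ?case by simp }
next
  case (insert a A)
  have eq: "(\<lambda>k. if k \<in> insert a A then - z k else z k) =
      (\<lambda>k. if k \<in> A then - (z(a := -1 * z a + 0)) k else (z(a := -1 * z a + 0)) k)" for z :: "nat \<Rightarrow> real"
    using insert.hyps by (auto simp: fun_eq_iff)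
  {
    case 1
    have "(\<lambda>z. F (\<lambda>k. if k \<in> A then - z k else z k)) \<in> borel_measurable (Leb K)"
      using 1 by (intro measurable_compose[OF insert.IH(2) F]) auto
    from nn_integral_Leb_coordinate[OF K _ this, of a "\<lambda>_. 0" "-1"] show ?case
      unfolding eq using insert.IH(1) 1 by simp
  next
    case 2
    have "(\<lambda>z. z(a := -1 * z a + 0)) \<in> Leb K \<rightarrow>\<^sub>M Leb K"
      using 2 by (intro measurable_fun_upd_Leb) auto
    from measurable_compose[OF this insert.IH(2)] 2 show ?case unfolding eq by auto
  }
qed

section \<open>Adaptive algorithms on rotation invariant distributions\<close>

lemma values_upto_Cons:
  assumes "q [] = Some x"
  shows "values_upto q u (Suc j) = u x # values_upto (\<lambda>ys. q (u x # ys)) u j"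
proof (induction j)
  case 0
  then show ?case using assms by simp
next
  case (Suc j)
  have "values_upto q u (Suc (Suc j)) = (case q (values_upto q u (Suc j)) of
        None \<Rightarrow> values_upto q u (Suc j) | Some x \<Rightarrow> values_upto q u (Suc j) @ [u x])"
    by (rule values_upto.simps(2))
  then show ?case unfolding Suc.IH by (simp split: option.splits)
qed

text \<open>The remaining strategy \<open>q'\<close> depends on \<open>u\<close> only through the
  value \<open>u x\<close>. Functions that agree at \<open>x\<close> therefore share one remaining
  algorithm, which is what an induction over queries needs.\<close>

lemma first_query:
  assumes q: "q [] = Some x" and t: "terminates q u"
  defines "q' \<equiv> \<lambda>ys. q (u x # ys)"
  shows "terminates q' u" "num_values q u = Suc (num_values q' u)"
    "std_info q u = u x # std_info q' u"
proof -
  have V: "values_upto q u (Suc j) = u x # values_upto q' u j" for j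
    unfolding q'_def by (rule values_upto_Cons[of q x, OF q])
  have stop: "q (values_upto q u (Suc j)) = None \<longleftrightarrow> q' (values_upto q' u j) = None" for j
    unfolding V by (simp add: q'_def)
  from t obtain j where j: "q (values_upto q u j) = None" by (auto simp: terminates_def)
  moreover have not0: "q (values_upto q u 0) \<noteq> None" using q by simp
  ultimately obtain j' where "j = Suc j'" by (cases j) auto
  with j stop show "terminates q' u" unfolding terminates_def by blast
  show num: "num_values q u = Suc (num_values q' u)"
    unfolding num_values_def using Least_Suc[of "\<lambda>j. q (values_upto q u j) = None", OF j not0]
    by (simp only: stop)
  show "std_info q u = u x # std_info q' u"
    unfolding std_info_def num by (rule V)
qed

section \<open>Second moments under a radial weight\<close>

lemma weighted_sqnorm_measurable:
  assumes "\<rho> \<in> borel_measurable borel" "X \<subseteq> K"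
  shows "(\<lambda>z. \<rho> (sqnorm K z) * ennreal (sqnorm X z)) \<in> borel_measurable (Leb K)"
  using measurable_compose[OF measurable_sqnorm[of K K] assms(1)]
    measurable_compose[OF measurable_sqnorm[OF assms(2)] measurable_ennreal]
  by simp

text \<open>A quarter turn in the plane of \<open>i\<close> and \<open>j\<close> exchanges the
  squares of the two coordinates and leaves the radial weight unchanged.\<close>

lemma second_moment_coordinates:
  assumes K: "finite K" "i \<in> K" "j \<in> K" and \<rho>: "\<rho> \<in> borel_measurable borel"
  shows "(\<integral>\<^sup>+z. \<rho> (sqnorm K z) * ennreal ((z i)\<^sup>2) \<partial>Leb K) =
         (\<integral>\<^sup>+z. \<rho> (sqnorm K z) * ennreal ((z j)\<^sup>2) \<partial>Leb K)"
proof (cases "i = j")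
  case False
  then have G: "Leb_isometry K (givens i j 0 1)"
    using K by (intro Leb_isometry_givens) auto
  have "(\<lambda>z. \<rho> (sqnorm K z) * ennreal ((z i)\<^sup>2)) \<in> borel_measurable (Leb K)"
    using K measurable_compose[OF measurable_sqnorm[of K K] \<rho>]
    by (intro borel_measurable_times_ennreal) auto
  then have "(\<integral>\<^sup>+z. \<rho> (sqnorm K z) * ennreal ((z i)\<^sup>2) \<partial>Leb K) =
      (\<integral>\<^sup>+z. \<rho> (sqnorm K (givens i j 0 1 z)) * ennreal ((givens i j 0 1 z i)\<^sup>2) \<partial>Leb K)"
    by (rule Leb_isometry_nn_integral[OF G, symmetric])
  also have "\<dots> = (\<integral>\<^sup>+z. \<rho> (sqnorm K z) * ennreal ((z j)\<^sup>2) \<partial>Leb K)"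
    using G False by (simp add: Leb_isometry_def) (simp add: givens_def)
  finally show ?thesis .
qed simp

text \<open>
  With \<open>d = card K\<close> and \<open>J\<close> the common second moment of the coordinates this is
  \<open>b d\<^sup>2 J \<le> 2 b d J + b (d - 1)\<^sup>2 J\<close>; the weight \<open>b d\<close> on the left is the
  value function of the induction over queries in \<open>adaptive_lower_bound\<close>.
\<close>

lemma second_moment_step:
  fixes b :: real
  assumes K: "finite K" "i \<in> K" and \<rho>: "\<rho> \<in> borel_measurable borel" "\<And>r. r \<ge> 1 \<Longrightarrow> \<rho> r = 0"
    and b: "0 \<le> b"
  shows "ennreal (b * card K) * (\<integral>\<^sup>+z. \<rho> (sqnorm K z) * ennreal (sqnorm K z) \<partial>Leb K) \<le>
    (\<integral>\<^sup>+z. \<rho> (sqnorm K z) * ennreal (2 * b + b * card (K - {i}) * sqnorm (K - {i}) z) \<partial>Leb K)"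
proof -
  have m\<rho>: "(\<lambda>z. \<rho> (sqnorm K z)) \<in> borel_measurable (Leb K)"
    by (rule measurable_compose[OF measurable_sqnorm \<rho>(1)]) simp
  define J where "J = (\<integral>\<^sup>+z. \<rho> (sqnorm K z) * ennreal ((z i)\<^sup>2) \<partial>Leb K)"
  \<comment> \<open>All coordinates have the same second moment \<open>J\<close>, so a partial
    squared norm is measured by counting coordinates.\<close>
  have sub: "(\<integral>\<^sup>+z. \<rho> (sqnorm K z) * ennreal (sqnorm X z) \<partial>Leb K) = of_nat (card X) * J"
    if X: "X \<subseteq> K" for X
  proof -
    have "(\<integral>\<^sup>+z. \<rho> (sqnorm K z) * ennreal (sqnorm X z) \<partial>Leb K) =
        (\<integral>\<^sup>+z. (\<Sum>j\<in>X. \<rho> (sqnorm K z) * ennreal ((z j)\<^sup>2)) \<partial>Leb K)"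
      by (simp add: sqnorm_def[of X] sum_distrib_left[symmetric] sum_ennreal)
    also have "\<dots> = (\<Sum>j\<in>X. \<integral>\<^sup>+z. \<rho> (sqnorm K z) * ennreal ((z j)\<^sup>2) \<partial>Leb K)"
      using X m\<rho> by (intro nn_integral_sum borel_measurable_times_ennreal) auto
    also have "\<dots> = (\<Sum>j\<in>X. J)"
      unfolding J_def using X K \<rho> by (intro sum.cong second_moment_coordinates) auto
    finally show ?thesis by simp
  qed
  obtain d where d: "card K = Suc d" "card (K - {i}) = d"
    using card.remove[OF K] by simp
  have scale: "ennreal x * (of_nat m * J) = ennreal (x * real m) * J" if "0 \<le> x" for x m
    using that by (simp add: ennreal_of_nat_eq_real_of_nat ennreal_mult mult.assoc)
  have "ennreal (b * card K) * (\<integral>\<^sup>+z. \<rho> (sqnorm K z) * ennreal (sqnorm K z) \<partial>Leb K) =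
      ennreal (b * real (Suc d) * real (Suc d)) * J"
    unfolding sub[OF subset_refl] d using b by (intro scale) auto
  \<comment> \<open>This is \<open>(d + 1)^2 \<le> 2 * (d + 1) + d^2\<close>; it fixes the price
    \<open>2 * b\<close> charged for one query.\<close>
  also have "\<dots> \<le> ennreal (2 * b * real (Suc d) + b * d * d) * J"
    using b by (intro mult_right_mono ennreal_leI) (auto simp: algebra_simps)
  also have "\<dots> = ennreal (2 * b) * (of_nat (card K) * J) + ennreal (b * d) * (of_nat (card (K - {i})) * J)"
    unfolding d using b by (simp only: scale mult_nonneg_nonneg of_nat_0_le_iff zero_le_numeral)
      (simp add: ennreal_plus distrib_right)
  also have "\<dots> = ennreal (2 * b) * (\<integral>\<^sup>+z. \<rho> (sqnorm K z) * ennreal (sqnorm K z) \<partial>Leb K) +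
      ennreal (b * d) * (\<integral>\<^sup>+z. \<rho> (sqnorm K z) * ennreal (sqnorm (K - {i}) z) \<partial>Leb K)"
    by (simp only: sub[OF subset_refl] sub[OF Diff_subset])
  also have "\<dots> = (\<integral>\<^sup>+z. ennreal (2 * b) * (\<rho> (sqnorm K z) * ennreal (sqnorm K z)) +
      ennreal (b * d) * (\<rho> (sqnorm K z) * ennreal (sqnorm (K - {i}) z)) \<partial>Leb K)"
    using weighted_sqnorm_measurable[OF \<rho>(1) subset_refl]
      weighted_sqnorm_measurable[OF \<rho>(1) Diff_subset]
    by (subst nn_integral_add) (simp_all add: nn_integral_cmult)
  also have "\<dots> \<le> (\<integral>\<^sup>+z. \<rho> (sqnorm K z) * ennreal (2 * b + b * d * sqnorm (K - {i}) z) \<partial>Leb K)"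
  proof (intro nn_integral_mono)
    fix z
    show "ennreal (2 * b) * (\<rho> (sqnorm K z) * ennreal (sqnorm K z)) +
      ennreal (b * d) * (\<rho> (sqnorm K z) * ennreal (sqnorm (K - {i}) z)) \<le>
      \<rho> (sqnorm K z) * ennreal (2 * b + b * d * sqnorm (K - {i}) z)"
    \<comment> \<open>The support of \<open>\<rho>\<close> enters here: inside the unit ball
      \<open>2 * b * sqnorm K z\<close> is at most \<open>2 * b\<close>, and outside it the weight
      vanishes.\<close>
    proof (cases "sqnorm K z < 1")
      case True
      have "b * sqnorm K z \<le> b * 1"
        using b True by (intro mult_left_mono) auto
      then have "ennreal (2 * b * sqnorm K z + b * d * sqnorm (K - {i}) z) \<le>
          ennreal (2 * b + b * d * sqnorm (K - {i}) z)"
        by (intro ennreal_leI) simp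
      also have "ennreal (2 * b * sqnorm K z + b * d * sqnorm (K - {i}) z) =
          ennreal (2 * b) * ennreal (sqnorm K z) + ennreal (b * d) * ennreal (sqnorm (K - {i}) z)"
        using b sqnorm_nonneg[of K z] sqnorm_nonneg[of "K - {i}" z]
        by (simp only: ennreal_plus ennreal_mult mult_nonneg_nonneg of_nat_0_le_iff zero_le_numeral)
      finally have "\<rho> (sqnorm K z) * (ennreal (2 * b) * ennreal (sqnorm K z) +
          ennreal (b * d) * ennreal (sqnorm (K - {i}) z)) \<le>
          \<rho> (sqnorm K z) * ennreal (2 * b + b * d * sqnorm (K - {i}) z)"
        by (rule mult_left_mono) simp
      then show ?thesis by (simp only: distrib_left mult.left_commute)
    qed (simp add: \<rho>(2))
  qed
  finally show ?thesis by (simp add: d)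
qed

text \<open>One constant output \<open>g\<close> must serve both \<open>z\<close> and its negative.
  By the parallelogram law the two squared errors add up to at least half of the squared distance of
  the images, which is at least \<open>2 * b * sqnorm K z\<close>. Expansion is assumed of
  \<open>T\<close> instead of linearity because fixing coordinates introduces offsets.\<close>

lemma symmetrized_error:
  fixes T :: "(nat \<Rightarrow> real) \<Rightarrow> 'g::real_inner" and b :: real
  assumes K: "finite K" and \<rho>: "\<rho> \<in> borel_measurable borel" and b: "0 \<le> b"
    and T: "\<And>z z'. b * (\<Sum>k\<in>K. (z k - z' k)\<^sup>2) \<le> (norm (T z - T z'))\<^sup>2"
    and err: "(\<lambda>z. (norm (T z - g))\<^sup>2) \<in> borel_measurable (Leb K)"
  shows "ennreal b * (\<integral>\<^sup>+z. \<rho> (sqnorm K z) * ennreal (sqnorm K z) \<partial>Leb K) \<le>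
    (\<integral>\<^sup>+z. \<rho> (sqnorm K z) * ennreal ((norm (T z - g))\<^sup>2) \<partial>Leb K)"
    (is "ennreal b * ?I \<le> ?E")
proof -
  define m where "m = (\<lambda>(z::nat \<Rightarrow> real) k. if k \<in> K then - z k else z k)"
  have mm: "m \<in> Leb K \<rightarrow>\<^sub>M Leb K"
    unfolding m_def using K by (intro nn_integral_Leb_uminus(2)[of K "\<lambda>_. 0"]) auto
  have m\<rho>: "(\<lambda>z. \<rho> (sqnorm K z)) \<in> borel_measurable (Leb K)"
    by (rule measurable_compose[OF measurable_sqnorm \<rho>]) simp
  have F: "(\<lambda>z. \<rho> (sqnorm K z) * ennreal ((norm (T z - g))\<^sup>2)) \<in> borel_measurable (Leb K)"
    using m\<rho> err by simp
  have sq: "sqnorm K (m z) = sqnorm K z" for z by (simp add: sqnorm_def m_def)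
  have Em: "(\<integral>\<^sup>+z. \<rho> (sqnorm K z) * ennreal ((norm (T (m z) - g))\<^sup>2) \<partial>Leb K) = ?E"
    using nn_integral_Leb_uminus(1)[OF K F K subset_refl] sq by (simp add: m_def)
  have pt: "2 * b * sqnorm K z \<le> (norm (T z - g))\<^sup>2 + (norm (T (m z) - g))\<^sup>2" for z
  proof -
    have "(\<Sum>k\<in>K. (z k - m z k)\<^sup>2) = 4 * sqnorm K z"
      by (simp add: m_def sqnorm_def sum_distrib_left power2_eq_square)
    then have "4 * b * sqnorm K z \<le> (norm (T z - T (m z)))\<^sup>2" using T[of z "m z"] by simp
    also have "\<dots> = (norm ((T z - g) - (T (m z) - g)))\<^sup>2" by simp
    also have "\<dots> \<le> 2 * ((norm (T z - g))\<^sup>2 + (norm (T (m z) - g))\<^sup>2)"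
      using zero_le_power2[of "norm ((T z - g) + (T (m z) - g))"]
      by (simp add: power2_norm_eq_inner inner_diff inner_add inner_commute algebra_simps)
    finally show ?thesis by simp
  qed
  have "2 * (ennreal b * ?I) = (\<integral>\<^sup>+z. \<rho> (sqnorm K z) * ennreal (2 * b * sqnorm K z) \<partial>Leb K)"
  proof -
    have "ennreal (2 * b * sqnorm K z) = ennreal (2 * b) * ennreal (sqnorm K z)" for z
      using b sqnorm_nonneg by (intro ennreal_mult) auto
    then have "(\<integral>\<^sup>+z. \<rho> (sqnorm K z) * ennreal (2 * b * sqnorm K z) \<partial>Leb K) =
        (\<integral>\<^sup>+z. ennreal (2 * b) * (\<rho> (sqnorm K z) * ennreal (sqnorm K z)) \<partial>Leb K)"
      by (simp add: ac_simps)
    also have "\<dots> = ennreal (2 * b) * ?I"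
      by (intro nn_integral_cmult weighted_sqnorm_measurable \<rho> subset_refl)
    also have "\<dots> = 2 * (ennreal b * ?I)"
      using b by (simp add: ennreal_mult mult.assoc)
    finally show ?thesis by simp
  qed
  also have "\<dots> \<le> (\<integral>\<^sup>+z. \<rho> (sqnorm K z) * ennreal ((norm (T z - g))\<^sup>2) +
      \<rho> (sqnorm K z) * ennreal ((norm (T (m z) - g))\<^sup>2) \<partial>Leb K)"
    using pt by (intro nn_integral_mono)
      (auto simp: distrib_left[symmetric] ennreal_plus[symmetric] simp del: ennreal_plus
        intro!: mult_left_mono ennreal_leI)
  also have "\<dots> = ?E + ?E"
    using F measurable_compose[OF mm F] by (subst nn_integral_add) (auto simp: Em sq)
  finally have "2 * (ennreal b * ?I) \<le> 2 * ?E" by (simp add: mult_2)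
  then show ?thesis by (simp add: ennreal_mult_le_mult_iff)
qed

text \<open>
  The induction removes one coordinate per query: after a rotation the queried functional is a
  coordinate, which is then fixed by Fubini's theorem.  This needs measurability of the error and
  the cost only; the choice of the sampling points need not be measurable.
\<close>

lemma adaptive_lower_bound:
  fixes T :: "(nat \<Rightarrow> real) \<Rightarrow> 'g::real_inner" and u :: "(nat \<Rightarrow> real) \<Rightarrow> 'd \<Rightarrow> real" and N :: nat and b :: real
  assumes "finite K" and "card K \<le> N"
    and "\<rho> \<in> borel_measurable borel" "\<And>r. r \<ge> 1 \<Longrightarrow> \<rho> r = 0" and "0 \<le> b"
    and "\<And>x. \<exists>\<alpha> \<beta>. \<forall>z. u z x = \<alpha> + (\<Sum>k\<in>K. \<beta> k * z k)"
    and "\<And>z z'. b * (\<Sum>k\<in>K. (z k - z' k)\<^sup>2) \<le> (norm (T z - T z'))\<^sup>2"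
    and "\<And>z. terminates q (u z)"
    and "(\<lambda>z. (norm (T z - \<phi> (std_info q (u z))))\<^sup>2) \<in> borel_measurable (Leb K)"
    and "(\<lambda>z. real (num_values q (u z))) \<in> borel_measurable (Leb K)"
  shows "ennreal (b * card K) * (\<integral>\<^sup>+z. \<rho> (sqnorm K z) * ennreal (sqnorm K z) \<partial>Leb K) \<le>
    (\<integral>\<^sup>+z. \<rho> (sqnorm K z) * ennreal (N * (norm (T z - \<phi> (std_info q (u z))))\<^sup>2 +
        2 * b * num_values q (u z)) \<partial>Leb K)"
  using assms
proof (induction "card K" arbitrary: K \<rho> u T q \<phi>)
  case 0
  then show ?case by simp
next
  case (Suc d)
  note K = \<open>finite K\<close> \<open>card K \<le> N\<close> and \<rho> = Suc.prems(3,4) and b = \<open>0 \<le> b\<close> and u = Suc.prems(6)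
    and T = Suc.prems(7) and trm = Suc.prems(8) and err = Suc.prems(9) and num = Suc.prems(10)
  have m\<rho>: "(\<lambda>z. \<rho> (sqnorm K z)) \<in> borel_measurable (Leb K)"
    by (rule measurable_compose[OF measurable_sqnorm \<rho>(1)]) simp
  show ?case
  proof (cases "q []")
    \<comment> \<open>Without a query the output is the constant \<open>\<phi> []\<close>, so
      symmetrization applies; \<open>card K \<le> N\<close> lets the factor \<open>N\<close> on the
      squared error dominate the weight \<open>card K\<close>.\<close>
    case None
    then have [simp]: "num_values q v = 0" "std_info q v = []" for v
      by (auto simp: num_values_def std_info_def)
    have "ennreal (b * card K) * (\<integral>\<^sup>+z. \<rho> (sqnorm K z) * ennreal (sqnorm K z) \<partial>Leb K) \<le>
        ennreal (b * N) * (\<integral>\<^sup>+z. \<rho> (sqnorm K z) * ennreal (sqnorm K z) \<partial>Leb K)"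
      using K b by (intro mult_right_mono ennreal_leI mult_left_mono) auto
    also have "\<dots> = ennreal N * (ennreal b * (\<integral>\<^sup>+z. \<rho> (sqnorm K z) * ennreal (sqnorm K z) \<partial>Leb K))"
      using b by (simp add: ennreal_mult ac_simps)
    also have "\<dots> \<le> ennreal N * (\<integral>\<^sup>+z. \<rho> (sqnorm K z) * ennreal ((norm (T z - \<phi> []))\<^sup>2) \<partial>Leb K)"
      using K \<rho> b T err by (intro mult_left_mono symmetrized_error) auto
    also have "\<dots> = (\<integral>\<^sup>+z. ennreal N * (\<rho> (sqnorm K z) * ennreal ((norm (T z - \<phi> []))\<^sup>2)) \<partial>Leb K)"
      using m\<rho> err by (intro nn_integral_cmult[symmetric]) auto
    finally show ?thesis by (simp add: ennreal_mult ac_simps)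
  next
    case (Some x)
    obtain \<alpha> \<beta> where ux: "\<And>z. u z x = \<alpha> + (\<Sum>k\<in>K. \<beta> k * z k)" using u[of x] by blast
    have "K \<noteq> {}" using \<open>Suc d = card K\<close> by auto
    from rotate_functional_to_coordinate[OF K(1) this, of \<beta>] obtain R i \<gamma>
      where R: "Leb_isometry K R" and i: "i \<in> K" and Rx: "\<And>z. (\<Sum>k\<in>K. \<beta> k * R z k) = \<gamma> * z i"
      by blast
    define K' where "K' = K - {i}"
    have K': "K = insert i K'" "i \<notin> K'" "finite K'" "d = card K'"
      using K i \<open>Suc d = card K\<close> by (auto simp: K'_def)
    have mR: "R \<in> Leb K \<rightarrow>\<^sub>M Leb K" using R by (simp add: Leb_isometry_def)
    define H where "H z = N * (norm (T z - \<phi> (std_info q (u z))))\<^sup>2 + 2 * b * num_values q (u z)" for z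
    have mH: "(\<lambda>z. ennreal (H z)) \<in> borel_measurable (Leb K)"
      unfolding H_def using err num by simp
    have mF: "(\<lambda>z. \<rho> (sqnorm K z) * ennreal (H z)) \<in> borel_measurable (Leb K)"
      using m\<rho> mH by simp
    have mF': "(\<lambda>z. \<rho> (sqnorm K z) * ennreal (H (R z))) \<in> borel_measurable (Leb K)"
      using m\<rho> measurable_compose[OF mR mH] by simp
    have mG: "(\<lambda>z. \<rho> (sqnorm K z) * ennreal (2 * b + b * d * sqnorm K' z)) \<in> borel_measurable (Leb K)"
      by (intro borel_measurable_times_ennreal m\<rho> measurable_compose[OF _ measurable_ennreal]
          borel_measurable_add borel_measurable_times borel_measurable_const measurable_sqnorm)
        (simp add: K'_def)
    \<comment> \<open>After the rotation the query sees only \<open>z i\<close>. With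
      \<open>z i = t\<close> fixed, the inequality is the induction hypothesis on \<open>K'\<close>
      plus the price \<open>2 * b\<close> of this query.\<close>
    have slice: "(\<integral>\<^sup>+z. \<rho> (sqnorm K (z(i := t))) * ennreal (2 * b + b * d * sqnorm K' (z(i := t))) \<partial>Leb K') \<le>
      (\<integral>\<^sup>+z. \<rho> (sqnorm K (z(i := t))) * ennreal (H (R (z(i := t)))) \<partial>Leb K')" for t
    proof -
      \<comment> \<open>\<open>y\<close> is the observed value. It is the same on the whole slice,
        so \<open>q'\<close> and \<open>\<phi>'\<close> form one fixed algorithm for the coordinates
        left.\<close>
      define y where "y = \<alpha> + \<gamma> * t"
      define P where "P z = R (z(i := t))" for z
      define q' where "q' ys = q (y # ys)" for ys
      define \<phi>' where "\<phi>' ys = \<phi> (y # ys)" for ys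
      \<comment> \<open>The weight restricted to a slice is radial again, and since
        \<open>t^2 \<ge> 0\<close> it still vanishes from 1 on. This is why the induction
        generalizes over \<open>\<rho>\<close>.\<close>
      define \<rho>' where "\<rho>' r = \<rho> (t\<^sup>2 + r)" for r
      have upd: "(\<lambda>z. z(i := t)) \<in> Leb K' \<rightarrow>\<^sub>M Leb K"
        unfolding K'(1) by (rule measurable_fun_upd) auto
      have mP: "P \<in> Leb K' \<rightarrow>\<^sub>M Leb K"
        unfolding P_def using measurable_compose[OF upd mR] .
      have uP: "u (P z) x = y" for z
        by (simp add: ux P_def Rx y_def)
      have first: "terminates q' (u (P z))" "num_values q (u (P z)) = Suc (num_values q' (u (P z)))"
        "\<phi> (std_info q (u (P z))) = \<phi>' (std_info q' (u (P z)))" for z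
        using first_query[of q x, OF Some trm[of "P z"]] unfolding uP q'_def[abs_def, symmetric] \<phi>'_def
        by simp_all
      have sq: "sqnorm K (z(i := t)) = t\<^sup>2 + sqnorm K' z" "sqnorm K' (z(i := t)) = sqnorm K' z" for z
        using K' by (auto simp: sqnorm_def intro!: sum.cong)
      have err': "(\<lambda>z. (norm (T (P z) - \<phi>' (std_info q' (u (P z)))))\<^sup>2) \<in> borel_measurable (Leb K')"
        using measurable_compose[OF mP err] by (simp add: first)
      have "(\<lambda>z. real (num_values q (u (P z))) - 1) \<in> borel_measurable (Leb K')"
        using measurable_compose[OF mP num] by simp
      then have num': "(\<lambda>z. real (num_values q' (u (P z)))) \<in> borel_measurable (Leb K')"
        by (simp add: first)
      have m\<rho>': "\<rho>' \<in> borel_measurable borel"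
        unfolding \<rho>'_def using measurable_compose[OF _ \<rho>(1), of "\<lambda>r. t\<^sup>2 + r" borel] by simp
      have \<rho>'0: "\<rho>' r = 0" if "1 \<le> r" for r
        using that zero_le_power2[of t] unfolding \<rho>'_def by (intro \<rho>(2)) linarith
      \<comment> \<open>The fixed coordinate contributes the constant \<open>\<beta>2 i * t\<close>;
        function values stay affine, though not linear, along the induction.\<close>
      have affine: "\<exists>\<alpha> \<beta>. \<forall>z. u (P z) w = \<alpha> + (\<Sum>k\<in>K'. \<beta> k * z k)" for w
      proof -
        obtain \<alpha>1 \<beta>1 where 1: "\<And>z. u z w = \<alpha>1 + (\<Sum>k\<in>K. \<beta>1 k * z k)" using u[of w] by blast
        obtain \<beta>2 where 2: "\<And>z. (\<Sum>k\<in>K. \<beta>1 k * R z k) = (\<Sum>k\<in>K. \<beta>2 k * z k)"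
          using R unfolding Leb_isometry_def by metis
        have "u (P z) w = (\<alpha>1 + \<beta>2 i * t) + (\<Sum>k\<in>K'. \<beta>2 k * z k)" for z
          unfolding 1 P_def 2 using K' by (auto intro!: sum.cong)
        then show ?thesis by blast
      qed
      have T': "b * (\<Sum>k\<in>K'. (z k - z' k)\<^sup>2) \<le> (norm (T (P z) - T (P z')))\<^sup>2" for z z'
      proof -
        have "(\<Sum>k\<in>K. (P z k - P z' k)\<^sup>2) = (\<Sum>k\<in>K. ((z(i := t)) k - (z'(i := t)) k)\<^sup>2)"
          using R by (simp add: P_def Leb_isometry_def)
        also have "\<dots> = (\<Sum>k\<in>K'. (z k - z' k)\<^sup>2)"
          unfolding K'(1) using K'(2,3) by (auto intro!: sum.cong)
        finally show ?thesis using T[of "P z" "P z'"] by simp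
      qed
      have IH: "ennreal (b * d) * (\<integral>\<^sup>+z. \<rho>' (sqnorm K' z) * ennreal (sqnorm K' z) \<partial>Leb K') \<le>
        (\<integral>\<^sup>+z. \<rho>' (sqnorm K' z) * ennreal (N * (norm (T (P z) - \<phi>' (std_info q' (u (P z)))))\<^sup>2 +
          2 * b * num_values q' (u (P z))) \<partial>Leb K')"
        unfolding K'(4)
        by (rule Suc.hyps(1)[OF K'(4,3) _ m\<rho>' \<rho>'0 b affine T' first(1) err' num'])
          (use K(2) \<open>Suc d = card K\<close> K'(4) in simp_all)
      have m1: "(\<lambda>z. \<rho>' (sqnorm K' z)) \<in> borel_measurable (Leb K')"
        by (rule measurable_compose[OF measurable_sqnorm m\<rho>']) simp
      have m2: "(\<lambda>z. \<rho>' (sqnorm K' z) * ennreal (sqnorm K' z)) \<in> borel_measurable (Leb K')"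
        by (intro weighted_sqnorm_measurable m\<rho>' subset_refl)
      have "(\<integral>\<^sup>+z. \<rho> (sqnorm K (z(i := t))) * ennreal (2 * b + b * d * sqnorm K' (z(i := t))) \<partial>Leb K') =
        (\<integral>\<^sup>+z. \<rho>' (sqnorm K' z) * ennreal (2 * b) + ennreal (b * d) * (\<rho>' (sqnorm K' z) * ennreal (sqnorm K' z)) \<partial>Leb K')"
        using b sqnorm_nonneg[of K'] by (simp add: sq \<rho>'_def distrib_left ennreal_mult ac_simps)
      also have "\<dots> = (\<integral>\<^sup>+z. \<rho>' (sqnorm K' z) * ennreal (2 * b) \<partial>Leb K') +
          ennreal (b * d) * (\<integral>\<^sup>+z. \<rho>' (sqnorm K' z) * ennreal (sqnorm K' z) \<partial>Leb K')"
        using m1 m2 by (subst nn_integral_add) (auto simp: nn_integral_cmult)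
      also have "\<dots> \<le> (\<integral>\<^sup>+z. \<rho>' (sqnorm K' z) * ennreal (2 * b) \<partial>Leb K') +
        (\<integral>\<^sup>+z. \<rho>' (sqnorm K' z) * ennreal (N * (norm (T (P z) - \<phi>' (std_info q' (u (P z)))))\<^sup>2 +
          2 * b * num_values q' (u (P z))) \<partial>Leb K')"
        by (intro add_left_mono IH)
      also have "\<dots> = (\<integral>\<^sup>+z. \<rho>' (sqnorm K' z) * ennreal (2 * b) +
        \<rho>' (sqnorm K' z) * ennreal (N * (norm (T (P z) - \<phi>' (std_info q' (u (P z)))))\<^sup>2 +
          2 * b * num_values q' (u (P z))) \<partial>Leb K')"
        using m1 err' num' by (intro nn_integral_add[symmetric]) auto
      also have "\<dots> = (\<integral>\<^sup>+z. \<rho> (sqnorm K (z(i := t))) * ennreal (H (R (z(i := t)))) \<partial>Leb K')"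
      proof (rule nn_integral_cong)
        fix z
        \<comment> \<open>The extra \<open>2 * b\<close> pays for the first query, since the full
          cost is one more than the cost of \<open>q'\<close>.\<close>
        have "ennreal (2 * b) + ennreal (N * (norm (T (P z) - \<phi>' (std_info q' (u (P z)))))\<^sup>2 +
          2 * b * num_values q' (u (P z))) = ennreal (H (P z))"
          using b by (simp add: H_def first ennreal_plus[symmetric] algebra_simps del: ennreal_plus)
        then show "\<rho>' (sqnorm K' z) * ennreal (2 * b) +
          \<rho>' (sqnorm K' z) * ennreal (N * (norm (T (P z) - \<phi>' (std_info q' (u (P z)))))\<^sup>2 +
          2 * b * num_values q' (u (P z))) = \<rho> (sqnorm K (z(i := t))) * ennreal (H (R (z(i := t))))"
          by (simp add: distrib_left[symmetric] sq \<rho>'_def P_def)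
      qed
      finally show ?thesis .
    qed
    \<comment> \<open>The second moment step lowers the dimension, Fubini passes to the slices and
      back, and finally \<open>R\<close> is removed because it preserves the radius and the
      measure.\<close>
    have "ennreal (b * card K) * (\<integral>\<^sup>+z. \<rho> (sqnorm K z) * ennreal (sqnorm K z) \<partial>Leb K) \<le>
        (\<integral>\<^sup>+z. \<rho> (sqnorm K z) * ennreal (2 * b + b * d * sqnorm K' z) \<partial>Leb K)"
      using second_moment_step[OF K(1) i \<rho> b] by (simp add: K'(4) K'_def)
    also have "\<dots> = (\<integral>\<^sup>+t. (\<integral>\<^sup>+z. \<rho> (sqnorm K (z(i := t))) *
        ennreal (2 * b + b * d * sqnorm K' (z(i := t))) \<partial>Leb K') \<partial>lborel)"
      using Leb.product_nn_integral_insert_rev[OF K'(3,2) mG[unfolded K'(1)]] by (simp add: K'(1))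
    also have "\<dots> \<le> (\<integral>\<^sup>+t. (\<integral>\<^sup>+z. \<rho> (sqnorm K (z(i := t))) * ennreal (H (R (z(i := t)))) \<partial>Leb K') \<partial>lborel)"
      by (intro nn_integral_mono slice)
    also have "\<dots> = (\<integral>\<^sup>+z. \<rho> (sqnorm K z) * ennreal (H (R z)) \<partial>Leb K)"
      using Leb.product_nn_integral_insert_rev[OF K'(3,2) mF'[unfolded K'(1)]] by (simp add: K'(1))
    also have "\<dots> = (\<integral>\<^sup>+z. \<rho> (sqnorm K (R z)) * ennreal (H (R z)) \<partial>Leb K)"
      using R by (simp add: Leb_isometry_def)
    also have "\<dots> = (\<integral>\<^sup>+z. \<rho> (sqnorm K z) * ennreal (H z) \<partial>Leb K)"
      by (rule Leb_isometry_nn_integral[OF R mF])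
    finally show ?thesis unfolding H_def .
  qed
qed

section \<open>Singular values\<close>

lemma riesz_representation:
  fixes l :: "'a::{real_inner, complete_space} \<Rightarrow> real"
  assumes l: "bounded_linear l"
  shows "\<exists>w. \<forall>x. l x = x \<bullet> w"
proof -
  \<comment> \<open>The representer minimizes \<open>Q\<close>; minimizing sequences are Cauchy by the parallelogram law.\<close>
  define Q where "Q x = x \<bullet> x - 2 * l x" for x
  interpret bounded_linear l by (rule l)
  obtain B where B: "\<And>x. \<bar>l x\<bar> \<le> norm x * B" using bounded by auto
  \<comment> \<open>Completing the square gives
    \<open>Q x \<ge> (norm x - B)^2 - B^2\<close>.\<close>
  have low: "- (B\<^sup>2) \<le> Q x" for x
  proof -
    have "0 \<le> (norm x - B)\<^sup>2" by simp
    moreover have "l x \<le> norm x * B" using B[of x] by simp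
    ultimately show ?thesis
      by (simp add: Q_def power2_norm_eq_inner[symmetric] power2_diff algebra_simps)
  qed
  define m where "m = Inf (range Q)"
  have m: "m \<le> Q x" for x
    unfolding m_def using low by (intro cInf_lower) (auto intro!: bdd_belowI[of _ "- (B\<^sup>2)"])
  have "\<exists>x. Q x < m + 1 / Suc n" for n
    using cInf_lessD[of "range Q" "m + 1 / Suc n"] unfolding m_def by auto
  then obtain X where X: "\<And>n. Q (X n) < m + 1 / Suc n" by metis
  \<comment> \<open>The parallelogram law expresses the distance through the values of
    \<open>Q\<close> at \<open>x\<close>, \<open>y\<close> and their midpoint, and the value at the
    midpoint is at least \<open>m\<close>.\<close>
  have par: "(norm (x - y))\<^sup>2 \<le> 2 * (Q x - m) + 2 * (Q y - m)" for x y
  proof -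
    have "4 * Q ((1/2) *\<^sub>R (x + y)) = (x + y) \<bullet> (x + y) - 4 * (l x + l y)"
    proof -
      have "l ((1/2) *\<^sub>R (x + y)) = (l x + l y) / 2" by (simp only: scale add) simp
      moreover have "((1/2) *\<^sub>R (x + y)) \<bullet> ((1/2) *\<^sub>R (x + y)) = (x + y) \<bullet> (x + y) / 4"
        by (simp only: inner_scaleR_left inner_scaleR_right)
      ultimately show ?thesis unfolding Q_def by simp
    qed
    then have "(norm (x - y))\<^sup>2 = 2 * Q x + 2 * Q y - 4 * Q ((1/2) *\<^sub>R (x + y))"
      unfolding Q_def[of x] Q_def[of y]
      by (simp add: power2_norm_eq_inner inner_diff inner_add inner_commute algebra_simps)
    then show ?thesis using m[of "(1/2) *\<^sub>R (x + y)"] by simp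
  qed
  have "Cauchy X"
  proof (rule metric_CauchyI)
    fix \<epsilon> :: real assume \<epsilon>: "\<epsilon> > 0"
    then obtain n where n: "1 / Suc n < \<epsilon>\<^sup>2 / 4"
      using reals_Archimedean[of "\<epsilon>\<^sup>2 / 4"] by (auto simp: inverse_eq_divide)
    have near: "Q (X i) - m < \<epsilon>\<^sup>2 / 4" if "i \<ge> n" for i
    proof -
      have "1 / Suc i \<le> 1 / Suc n" using that by (simp add: divide_simps)
      then show ?thesis using X[of i] n by simp
    qed
    have "dist (X i) (X j) < \<epsilon>" if "i \<ge> n" "j \<ge> n" for i j
    proof -
      have "(norm (X i - X j))\<^sup>2 < \<epsilon>\<^sup>2"
        using par[of "X i" "X j"] near[OF that(1)] near[OF that(2)] by simp
      then show ?thesis using \<epsilon> by (simp add: dist_norm power2_less_imp_less)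
    qed
    then show "\<exists>M. \<forall>i\<ge>M. \<forall>j\<ge>M. dist (X i) (X j) < \<epsilon>" by blast
  qed
  then obtain w where w: "X \<longlonglongrightarrow> w" by (meson Cauchy_convergent convergent_def)
  have "(\<lambda>n. Q (X n)) \<longlonglongrightarrow> Q w"
    unfolding Q_def by (intro tendsto_intros w tendsto)
  moreover have "(\<lambda>n. m + 1 / Suc n) \<longlonglongrightarrow> m + 0"
    by (intro tendsto_intros LIMSEQ_Suc lim_1_over_n)
  ultimately have "Q w \<le> m + 0"
    using X by (intro LIMSEQ_le[of "\<lambda>n. Q (X n)" _ "\<lambda>n. m + 1 / Suc n"]) (auto intro: less_imp_le)
  then have min: "Q w \<le> Q x" for x using m[of x] by simp
  have "l x = x \<bullet> w" for x
  proof (cases "x = 0")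
    case False
    define c where "c = x \<bullet> w - l x"
    \<comment> \<open>This \<open>t\<close> minimizes the quadratic
      \<open>Q (w + t *\<^sub>R x)\<close>. The minimum lies below \<open>Q w\<close> by
      \<open>c * c / (x \<bullet> x)\<close>, which forces \<open>c = 0\<close>.\<close>
    define t where "t = - c / (x \<bullet> x)"
    have xx: "x \<bullet> x > 0" using False by simp
    have "Q (w + t *\<^sub>R x) = Q w + 2 * t * c + t * t * (x \<bullet> x)"
      by (simp add: Q_def c_def add scale inner_add inner_commute algebra_simps)
    also have "t * t * (x \<bullet> x) = - c * t" using xx by (simp add: t_def)
    finally have "0 \<le> c * t" using min[of "w + t *\<^sub>R x"] by simp
    moreover have "c * t = - (c * c / (x \<bullet> x))" by (simp add: t_def)
    ultimately have "c * c / (x \<bullet> x) \<le> 0" by simp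
    then have "c * c \<le> 0" using xx by (simp add: divide_le_0_iff)
    then have "c = 0" using zero_le_square[of c] by (metis order_antisym mult_eq_0_iff)
    then show ?thesis by (simp add: c_def)
  qed (simp add: zero)
  then show ?thesis by blast
qed

text \<open>\<open>adjoint\<close> is a choice among the maps satisfying this identity; the Riesz
  representers of \<open>\<lambda>x. S x \<bullet> y\<close> show that such a map exists.\<close>

lemma adjoint_works_complete:
  fixes S :: "'a::{real_inner, complete_space} \<Rightarrow> 'b::real_inner"
  assumes "bounded_linear S"
  shows "x \<bullet> adjoint S y = S x \<bullet> y"
proof -
  have "\<exists>w. \<forall>x. S x \<bullet> y = x \<bullet> w" for y
    by (intro riesz_representation bounded_linear_compose[OF bounded_linear_inner_left assms])
  then obtain S' where "\<forall>x y. S x \<bullet> y = x \<bullet> S' y" by metis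
  with adjoint_unique[OF this] show ?thesis by simp
qed

section \<open>Expansions along the singular system and the truncation bound\<close>

lemma bessel_inequality:
  fixes f :: "'a::real_inner"
  assumes A: "finite A" and on: "\<And>i j. i \<in> A \<Longrightarrow> j \<in> A \<Longrightarrow> e i \<bullet> e j = (if i = j then 1 else 0)"
  shows "(\<Sum>i\<in>A. (f \<bullet> e i)\<^sup>2) \<le> (norm f)\<^sup>2"
proof -
  define P where "P = (\<Sum>i\<in>A. (f \<bullet> e i) *\<^sub>R e i)"
  have fP: "f \<bullet> P = (\<Sum>i\<in>A. (f \<bullet> e i)\<^sup>2)"
    by (simp add: P_def inner_sum_right power2_eq_square)
  have "P \<bullet> P = (\<Sum>i\<in>A. \<Sum>j\<in>A. (f \<bullet> e i) * ((f \<bullet> e j) * (e j \<bullet> e i)))"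
    by (simp add: P_def inner_sum_left inner_sum_right sum_distrib_left)
  also have "\<dots> = (\<Sum>i\<in>A. \<Sum>j\<in>A. if i = j then (f \<bullet> e i)\<^sup>2 else 0)"
    by (intro sum.cong) (auto simp: on power2_eq_square)
  also have "\<dots> = f \<bullet> P" using A by (simp add: fP sum.delta)
  finally have "(norm (f - P))\<^sup>2 = (norm f)\<^sup>2 - f \<bullet> P"
    by (simp add: power2_norm_eq_inner inner_diff inner_commute)
  then show ?thesis using zero_le_power2[of "norm (f - P)"] fP by simp
qed

lemma singular_system_orthonormal:
  "singular_system S I \<sigma> e \<Longrightarrow> i \<in> I \<Longrightarrow> j \<in> I \<Longrightarrow> e i \<bullet> e j = (if i = j then 1 else 0)"
  unfolding singular_system_def by blast

lemma inner_sum_singular_system: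
  assumes "singular_system S I \<sigma> e" "finite A" "A \<subseteq> I" "i \<in> I"
  shows "(\<Sum>j\<in>A. c j *\<^sub>R e j) \<bullet> e i = (if i \<in> A then c i else 0)"
proof -
  have "(\<Sum>j\<in>A. c j *\<^sub>R e j) \<bullet> e i = (\<Sum>j\<in>A. if j = i then c j else 0)"
    unfolding inner_sum_left
    using assms by (intro sum.cong) (auto simp: singular_system_orthonormal[OF assms(1)] subset_iff)
  then show ?thesis using assms(2) by simp
qed

text \<open>Pair the expansion of \<open>adjoint S (S f)\<close> with \<open>f\<close>. The singular
  vectors on the side of \<open>'g\<close> never have to be introduced.\<close>

lemma norm_singular_system_has_sum:
  fixes S :: "'f::{real_inner, complete_space} \<Rightarrow> 'g::real_inner"
  assumes S: "bounded_linear S" and ss: "singular_system S I \<sigma> e"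
  shows "((\<lambda>i. (\<sigma> i)\<^sup>2 * (f \<bullet> e i)\<^sup>2) has_sum (norm (S f))\<^sup>2) I"
proof -
  have "((\<lambda>i. (\<sigma> i)\<^sup>2 *\<^sub>R ((f \<bullet> e i) *\<^sub>R e i)) has_sum adjoint S (S f)) I"
    using ss unfolding singular_system_def by blast
  from has_sum_bounded_linear[OF bounded_linear_inner_right[of f] this] show ?thesis
    by (simp add: adjoint_works_complete[OF S] power2_norm_eq_inner) (simp add: power2_eq_square mult.assoc)
qed

text \<open>Each of the first \<open>m\<close> singular values is at least
  \<open>\<sigma> m\<close>, and a partial sum of the nonnegative series is at most its sum. This
  provides the expansion constant for \<open>adaptive_lower_bound\<close>.\<close>

lemma norm_combination_ge:
  fixes S :: "'f::{real_inner, complete_space} \<Rightarrow> 'g::real_inner"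
  assumes S: "bounded_linear S" and ss: "singular_system S I \<sigma> e" and m: "{1..m} \<subseteq> I"
  shows "(\<sigma> m)\<^sup>2 * (\<Sum>i=1..m. (c i)\<^sup>2) \<le> (norm (S (\<Sum>i=1..m. c i *\<^sub>R e i)))\<^sup>2"
proof -
  let ?f = "\<Sum>i=1..m. c i *\<^sub>R e i"
  have "(\<sigma> m)\<^sup>2 * (\<Sum>i=1..m. (c i)\<^sup>2) = (\<Sum>i=1..m. (\<sigma> m)\<^sup>2 * (c i)\<^sup>2)"
    by (rule sum_distrib_left)
  also have "\<dots> \<le> (\<Sum>i=1..m. (\<sigma> i)\<^sup>2 * (?f \<bullet> e i)\<^sup>2)"
  proof (intro sum_mono)
    fix i assume i: "i \<in> {1..m}"
    have "?f \<bullet> e i = c i"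
      using inner_sum_singular_system[OF ss _ m, of i c] i m by auto
    moreover have "0 \<le> \<sigma> m" "\<sigma> m \<le> \<sigma> i" using ss i unfolding singular_system_def by auto
    ultimately show "(\<sigma> m)\<^sup>2 * (c i)\<^sup>2 \<le> (\<sigma> i)\<^sup>2 * (?f \<bullet> e i)\<^sup>2"
      by (auto intro!: mult_right_mono power_mono)
  qed
  also have "\<dots> \<le> (norm (S ?f))\<^sup>2"
    using m by (intro has_sum_mono_neutral[OF has_sum_finite norm_singular_system_has_sum[OF S ss, of ?f]]) auto
  finally show ?thesis .
qed

text \<open>The remainder has coefficients only beyond \<open>m\<close>, where the singular values
  are at most \<open>\<sigma> (Suc m)\<close>. Bessel's inequality suffices, so the
  \<open>e i\<close> may be incomplete.\<close>

lemma truncation_error: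
  fixes S :: "'f::{real_inner, complete_space} \<Rightarrow> 'g::real_inner"
  assumes S: "bounded_linear S" and ss: "singular_system S I \<sigma> e"
  shows "norm (S (f - (\<Sum>i\<in>I \<inter> {1..m}. (f \<bullet> e i) *\<^sub>R e i))) \<le> \<sigma> (Suc m) * norm f"
proof -
  define g where "g = f - (\<Sum>i\<in>I \<inter> {1..m}. (f \<bullet> e i) *\<^sub>R e i)"
  have \<sigma>: "0 \<le> \<sigma> (Suc m)" using ss unfolding singular_system_def by auto
  have I: "I \<subseteq> {1..}" using ss unfolding singular_system_def by auto
  have ge: "g \<bullet> e i = (if i \<le> m then 0 else f \<bullet> e i)" if "i \<in> I" for i
    using inner_sum_singular_system[OF ss, of "I \<inter> {1..m}" i "\<lambda>i. f \<bullet> e i"] that I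
    by (auto simp: g_def inner_diff_left)
  have "(norm (S g))\<^sup>2 \<le> (\<sigma> (Suc m))\<^sup>2 * (norm f)\<^sup>2"
  proof (rule has_sum_le_finite_sums[OF norm_singular_system_has_sum[OF S ss]])
    fix A assume A: "finite A" "A \<subseteq> I"
    have "(\<Sum>i\<in>A. (\<sigma> i)\<^sup>2 * (g \<bullet> e i)\<^sup>2) \<le> (\<Sum>i\<in>A. (\<sigma> (Suc m))\<^sup>2 * (f \<bullet> e i)\<^sup>2)"
    proof (intro sum_mono)
      fix i assume i: "i \<in> A"
      show "(\<sigma> i)\<^sup>2 * (g \<bullet> e i)\<^sup>2 \<le> (\<sigma> (Suc m))\<^sup>2 * (f \<bullet> e i)\<^sup>2"
      proof (cases "i \<le> m")
        case False
        then have "0 \<le> \<sigma> i" "\<sigma> i \<le> \<sigma> (Suc m)" using ss unfolding singular_system_def by auto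
        then have "(\<sigma> i)\<^sup>2 \<le> (\<sigma> (Suc m))\<^sup>2" by (intro power_mono)
        moreover have "g \<bullet> e i = f \<bullet> e i" using ge[of i] i A(2) False by (simp add: subset_iff)
        ultimately show ?thesis by (simp add: mult_right_mono)
      qed (use ge[of i] i A(2) in \<open>simp add: subset_iff\<close>)
    qed
    also have "\<dots> = (\<sigma> (Suc m))\<^sup>2 * (\<Sum>i\<in>A. (f \<bullet> e i)\<^sup>2)" by (rule sum_distrib_left[symmetric])
    also have "\<dots> \<le> (\<sigma> (Suc m))\<^sup>2 * (norm f)\<^sup>2"
      using A singular_system_orthonormal[OF ss]
      by (intro mult_left_mono bessel_inequality) (auto simp: subset_iff)
    finally show "(\<Sum>i\<in>A. (\<sigma> i)\<^sup>2 * (g \<bullet> e i)\<^sup>2) \<le> (\<sigma> (Suc m))\<^sup>2 * (norm f)\<^sup>2" .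
  qed
  then have "(norm (S g))\<^sup>2 \<le> (\<sigma> (Suc m) * norm f)\<^sup>2" by (simp add: power_mult_distrib)
  then show ?thesis unfolding g_def[symmetric] by (rule power2_le_imp_le) (simp add: \<sigma>)
qed

lemma e_all_wor_le_singular_value:
  fixes S :: "'f::{real_inner, complete_space} \<Rightarrow> 'g::real_inner"
  assumes S: "bounded_linear S" and ss: "singular_system S I \<sigma> e"
  shows "e_all_wor S m \<le> ennreal (\<sigma> (Suc m))"
proof -
  \<comment> \<open>Indices up to \<open>m\<close> outside \<open>I\<close> occur only when the
    domain has dimension below \<open>m\<close>; the zero functional is used for them.\<close>
  define c where "c f i = (if i \<in> I then f \<bullet> e i else 0)" for f i
  \<comment> \<open>After \<open>length ys\<close> values the next index is one larger, as singular
    vectors are numbered from 1. The values themselves are ignored: the algorithm is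
    nonadaptive.\<close>
  define L where "L ys f = c f (Suc (length ys))" for ys :: "real list" and f
  define \<phi> where "\<phi> ys = (\<Sum>i<length ys. ys ! i *\<^sub>R S (e (Suc i)))" for ys
  have adm: "all_admissible m L"
    unfolding all_admissible_def
  proof (intro allI impI)
    fix ys :: "real list"
    have "L ys = (if Suc (length ys) \<in> I then \<lambda>f. f \<bullet> e (Suc (length ys)) else (\<lambda>_. 0))"
      by (auto simp: L_def c_def fun_eq_iff)
    then show "bounded_linear (L ys)"
      by (simp add: bounded_linear_inner_left bounded_linear_zero)
  qed
  have info: "all_info L f j = map (\<lambda>i. c f (Suc i)) [0..<j]" for f j
    by (induction j) (auto simp: L_def)
  have A: "\<phi> (all_info L f m) = S (\<Sum>i\<in>I \<inter> {1..m}. (f \<bullet> e i) *\<^sub>R e i)" for f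
  proof -
    interpret bounded_linear S by (rule S)
    have "\<phi> (all_info L f m) = (\<Sum>i<m. c f (Suc i) *\<^sub>R S (e (Suc i)))"
      by (simp add: \<phi>_def info)
    also have "\<dots> = (\<Sum>i=1..m. c f i *\<^sub>R S (e i))"
      by (simp add: sum.atLeast1_atMost_eq)
    also have "\<dots> = (\<Sum>i=1..m. if i \<in> I then (f \<bullet> e i) *\<^sub>R S (e i) else 0)"
      by (intro sum.cong) (auto simp: c_def)
    also have "\<dots> = (\<Sum>i\<in>I \<inter> {1..m}. (f \<bullet> e i) *\<^sub>R S (e i))"
      by (subst Int_commute) (simp add: sum.inter_restrict)
    finally show ?thesis by (simp add: sum scaleR)
  qed
  have "wor_error S (\<lambda>f. \<phi> (all_info L f m)) \<le> ennreal (\<sigma> (Suc m))"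
    unfolding wor_error_def
  proof (rule SUP_least)
    fix f :: 'f assume "f \<in> {f. norm f < 1}"
    have \<sigma>: "0 \<le> \<sigma> (Suc m)" using ss unfolding singular_system_def by auto
    have "norm (S f - \<phi> (all_info L f m)) \<le> \<sigma> (Suc m) * norm f"
      unfolding A using truncation_error[OF S ss, of f m]
      by (simp add: linear_diff[OF bounded_linear.linear[OF S]])
    also have "\<dots> \<le> \<sigma> (Suc m) * 1" using \<sigma> \<open>f \<in> _\<close> by (intro mult_left_mono) auto
    finally show "ennreal (norm (S f - \<phi> (all_info L f m))) \<le> ennreal (\<sigma> (Suc m))"
      by (simp add: ennreal_leI)
  qed
  then show ?thesis
    unfolding e_all_wor_def by (intro INF_lower2[of "(L, \<phi>)"]) (simp_all add: adm)
qed

section \<open>Everywhere defined representatives\<close>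

lemma function_classesD:
  assumes "function_classes cls"
  shows "cls f \<noteq> {}"
    and "u \<in> cls f \<Longrightarrow> u \<in> cls g \<Longrightarrow> f = g"
    and "u \<in> cls f \<Longrightarrow> v \<in> cls g \<Longrightarrow> (\<lambda>x. u x + v x) \<in> cls (f + g)"
    and "u \<in> cls f \<Longrightarrow> (\<lambda>x. c * u x) \<in> cls (c *\<^sub>R f)"
proof -
  have "\<forall>f g. f \<noteq> g \<longrightarrow> cls f \<inter> cls g = {}"
    using assms by (simp add: function_classes_def)
  then show "u \<in> cls f \<Longrightarrow> u \<in> cls g \<Longrightarrow> f = g" by blast
qed (use assms in \<open>simp_all add: function_classes_def\<close>)

lemma combination_in_class:
  fixes et :: "nat \<Rightarrow> 'd \<Rightarrow> real" and e :: "nat \<Rightarrow> 'f::real_inner"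
    and \<alpha> :: "nat \<Rightarrow> real"
  assumes "function_classes cls" "finite J" "\<forall>i\<in>J. et i \<in> cls (e i)"
  shows "(\<lambda>x. \<Sum>i\<in>J. \<alpha> i * et i x) \<in> cls (\<Sum>i\<in>J. \<alpha> i *\<^sub>R e i)"
  using assms(2,3)
proof (induction J)
  case empty
  \<comment> \<open>Scaling any representative of 0 by 0 shows that the zero function represents
    0.\<close>
  obtain u where "u \<in> cls 0" using function_classesD(1)[OF assms(1), of 0] by auto
  from function_classesD(4)[OF assms(1) this, of 0] show ?case by simp
next
  case (insert j J)
  have "et j \<in> cls (e j)" "(\<lambda>x. \<Sum>i\<in>J. \<alpha> i * et i x) \<in> cls (\<Sum>i\<in>J. \<alpha> i *\<^sub>R e i)"
    using insert by simp_all
  from function_classesD(3)[OF assms(1) function_classesD(4)[OF assms(1) this(1)] this(2)]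
  have "(\<lambda>x. \<alpha> j * et j x + (\<Sum>i\<in>J. \<alpha> i * et i x)) \<in>
      cls (\<alpha> j *\<^sub>R e j + (\<Sum>i\<in>J. \<alpha> i *\<^sub>R e i))" .
  then show ?case using insert.hyps by simp
qed

text \<open>The description in \<open>elem\<close> is unique because classes of distinct elements
  are disjoint: one function cannot represent two elements, whatever coefficients produce
  it.\<close>

lemma elem_combination:
  fixes et :: "nat \<Rightarrow> 'd \<Rightarrow> real" and e :: "nat \<Rightarrow> 'f::real_inner"
    and \<alpha> :: "nat \<Rightarrow> real"
  assumes "function_classes cls" "finite J" "\<forall>i\<in>J. et i \<in> cls (e i)"
  shows "elem J e et (\<lambda>x. \<Sum>i\<in>J. \<alpha> i * et i x) = (\<Sum>i\<in>J. \<alpha> i *\<^sub>R e i)"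
  unfolding elem_def
proof (rule the_equality)
  fix f assume "\<exists>\<beta> :: nat \<Rightarrow> real. (\<lambda>x. \<Sum>i\<in>J. \<alpha> i * et i x) = (\<lambda>x. \<Sum>i\<in>J. \<beta> i * et i x) \<and>
      f = (\<Sum>i\<in>J. \<beta> i *\<^sub>R e i)"
  then obtain \<beta> :: "nat \<Rightarrow> real" where \<beta>: "(\<lambda>x. \<Sum>i\<in>J. \<alpha> i * et i x) = (\<lambda>x. \<Sum>i\<in>J. \<beta> i * et i x)"
    "f = (\<Sum>i\<in>J. \<beta> i *\<^sub>R e i)" by blast
  show "f = (\<Sum>i\<in>J. \<alpha> i *\<^sub>R e i)"
  proof (rule function_classesD(2)[OF assms(1)])
    show "(\<lambda>x. \<Sum>i\<in>J. \<alpha> i * et i x) \<in> cls f"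
      unfolding \<beta> by (rule combination_in_class[OF assms])
  qed (rule combination_in_class[OF assms])
qed (intro exI[of _ \<alpha>] conjI refl)

lemma V_dist_combination:
  fixes et :: "nat \<Rightarrow> 'd \<Rightarrow> real" and e :: "nat \<Rightarrow> 'f::real_inner"
    and \<alpha> \<beta> :: "nat \<Rightarrow> real"
  assumes "function_classes cls" "finite J" "\<forall>i\<in>J. et i \<in> cls (e i)"
  shows "V_dist J e et (\<lambda>x. \<Sum>i\<in>J. \<alpha> i * et i x) (\<lambda>x. \<Sum>i\<in>J. \<beta> i * et i x) =
    norm (\<Sum>i\<in>J. (\<alpha> i - \<beta> i) *\<^sub>R e i)"
proof -
  have "(\<lambda>x. (\<Sum>i\<in>J. \<alpha> i * et i x) - (\<Sum>i\<in>J. \<beta> i * et i x)) = (\<lambda>x. \<Sum>i\<in>J. (\<alpha> i - \<beta> i) * et i x)"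
    by (simp add: sum_subtractf left_diff_distrib)
  then show ?thesis unfolding V_dist_def by (simp add: elem_combination[OF assms])
qed

text \<open>Definiteness comes from orthonormality: distance 0 forces the coefficients to agree,
  hence the functions to agree at every point. The lemma makes the topology behind
  \<open>V_borel\<close> usable.\<close>

lemma Metric_space_V:
  fixes et :: "nat \<Rightarrow> 'd \<Rightarrow> real" and e :: "nat \<Rightarrow> 'f::real_inner"
  assumes fc: "function_classes cls" "finite J" "\<forall>i\<in>J. et i \<in> cls (e i)"
    and ss: "singular_system S I \<sigma> e" "J \<subseteq> I"
  shows "Metric_space (V_space J et) (V_dist J e et)"
proof
  fix u v :: "'d \<Rightarrow> real"
  show "0 \<le> V_dist J e et u v" by (simp add: V_dist_def)
next
  fix u v assume "u \<in> V_space J et" "v \<in> V_space J et"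
  then obtain \<alpha> \<beta> :: "nat \<Rightarrow> real" where uv: "u = (\<lambda>x. \<Sum>i\<in>J. \<alpha> i * et i x)" "v = (\<lambda>x. \<Sum>i\<in>J. \<beta> i * et i x)"
    unfolding V_space_def by blast
  show "V_dist J e et u v = 0 \<longleftrightarrow> u = v"
  proof
    assume "V_dist J e et u v = 0"
    then have z: "(\<Sum>i\<in>J. (\<alpha> i - \<beta> i) *\<^sub>R e i) = 0"
      by (simp add: uv V_dist_combination[OF fc])
    have "\<alpha> i = \<beta> i" if i: "i \<in> J" for i
      using inner_sum_singular_system[OF ss(1) fc(2) ss(2), of i "\<lambda>i. \<alpha> i - \<beta> i"] z i ss(2) by auto
    then show "u = v" by (simp add: uv)
  next
    assume "u = v"
    then show "V_dist J e et u v = 0"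
      using V_dist_combination[OF fc, where \<alpha>=\<alpha> and \<beta>=\<alpha>] by (simp add: uv(1))
  qed
next
  fix u v w assume "u \<in> V_space J et" "v \<in> V_space J et" "w \<in> V_space J et"
  then obtain \<alpha> \<beta> \<gamma> :: "nat \<Rightarrow> real" where *: "u = (\<lambda>x. \<Sum>i\<in>J. \<alpha> i * et i x)" "v = (\<lambda>x. \<Sum>i\<in>J. \<beta> i * et i x)"
    "w = (\<lambda>x. \<Sum>i\<in>J. \<gamma> i * et i x)"
    unfolding V_space_def by blast
  have "(\<Sum>i\<in>J. (\<alpha> i - \<gamma> i) *\<^sub>R e i) = (\<Sum>i\<in>J. (\<alpha> i - \<beta> i) *\<^sub>R e i) + (\<Sum>i\<in>J. (\<beta> i - \<gamma> i) *\<^sub>R e i)"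
    by (simp add: sum.distrib[symmetric] scaleR_left.diff algebra_simps)
  then show "V_dist J e et u w \<le> V_dist J e et u v + V_dist J e et v w"
    unfolding * V_dist_combination[OF fc] using norm_triangle_ineq by metis
next
  fix u v
  show "V_dist J e et u v = V_dist J e et v u"
  proof -
    have neg: "(\<lambda>x. - w x) \<in> V_space J et" "elem J e et (\<lambda>x. - w x) = - elem J e et w"
      if wV: "w \<in> V_space J et" for w
    proof -
      obtain \<alpha> :: "nat \<Rightarrow> real" where w: "w = (\<lambda>x. \<Sum>i\<in>J. \<alpha> i * et i x)"
        using wV unfolding V_space_def by blast
      have w': "(\<lambda>x. - w x) = (\<lambda>x. \<Sum>i\<in>J. - \<alpha> i * et i x)"
        by (simp add: w sum_negf)
      show "(\<lambda>x. - w x) \<in> V_space J et"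
        unfolding w' V_space_def by (intro CollectI exI[of _ "\<lambda>i. - \<alpha> i"]) simp
      show "elem J e et (\<lambda>x. - w x) = - elem J e et w"
        unfolding w' unfolding w by (simp only: elem_combination[OF fc]) (simp add: sum_negf)
    qed
    define w where "w = (\<lambda>x. u x - v x)"
    have vu: "(\<lambda>x. v x - u x) = (\<lambda>x. - w x)" by (simp add: w_def)
    show ?thesis
    proof (cases "w \<in> V_space J et")
      case True
      then show ?thesis unfolding V_dist_def vu w_def[symmetric] by (simp add: neg)
    next
      \<comment> \<open>Symmetry is required for all functions: outside the space \<open>elem\<close> is a fixed junk value.\<close>
      case False
      then have "(\<lambda>x. - w x) \<notin> V_space J et" using neg(1)[of "\<lambda>x. - w x"] by auto
      moreover have "elem J e et w' = (THE f. False)" if "w' \<notin> V_space J et" for w'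
        using that unfolding elem_def V_space_def by (intro arg_cong[where f=The]) auto
      ultimately show ?thesis using False unfolding V_dist_def vu w_def[symmetric] by simp
    qed
  qed
qed

section \<open>From coordinate vectors to functions in the space\<close>

definition embed :: "nat set \<Rightarrow> nat set \<Rightarrow> (nat \<Rightarrow> 'd \<Rightarrow> real) \<Rightarrow> (nat \<Rightarrow> real) \<Rightarrow> 'd \<Rightarrow> real" where
  "embed J K et z = (\<lambda>x. \<Sum>i\<in>J. (if i \<in> K then z i else 0) * et i x)"

lemma embed_eq:
  assumes "finite J" "K \<subseteq> J"
  shows "embed J K et z x = (\<Sum>i\<in>K. et i x * z i)"
proof -
  have "embed J K et z x = (\<Sum>i\<in>J. if i \<in> K then et i x * z i else 0)"
    unfolding embed_def by (intro sum.cong) auto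
  also have "\<dots> = (\<Sum>i\<in>J \<inter> K. et i x * z i)"
    using assms(1) by (rule sum.inter_restrict[symmetric])
  finally show ?thesis using assms(2) by (simp add: Int_absorb1)
qed

lemma elem_embed:
  fixes et :: "nat \<Rightarrow> 'd \<Rightarrow> real" and e :: "nat \<Rightarrow> 'f::real_inner"
  assumes fc: "function_classes cls" "finite J" "\<forall>i\<in>J. et i \<in> cls (e i)" and K: "K \<subseteq> J"
  shows "elem J e et (embed J K et z) = (\<Sum>i\<in>K. z i *\<^sub>R e i)"
proof -
  have "elem J e et (embed J K et z) = (\<Sum>i\<in>J. if i \<in> K then z i *\<^sub>R e i else 0)"
    unfolding embed_def by (subst elem_combination[OF fc]) (auto intro: sum.cong)
  also have "\<dots> = (\<Sum>i\<in>J \<inter> K. z i *\<^sub>R e i)"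
    using fc(2) by (rule sum.inter_restrict[symmetric])
  finally show ?thesis using K by (simp add: Int_absorb1)
qed

lemma embed_in_V_space: "embed J K et z \<in> V_space J et"
  unfolding V_space_def embed_def by (intro CollectI exI[of _ "\<lambda>i. if i \<in> K then z i else 0"]) simp

text \<open>The distance depends on finitely many coordinates and continuously so; preimages of open
  sets are therefore open in the product topology. This transfers the measurability of a randomized
  algorithm from functions to coordinates.\<close>

lemma embed_measurable:
  fixes et :: "nat \<Rightarrow> 'd \<Rightarrow> real" and e :: "nat \<Rightarrow> 'f::real_inner"
  assumes fc: "function_classes cls" "finite J" "\<forall>i\<in>J. et i \<in> cls (e i)"
    and ss: "singular_system S I \<sigma> e" "J \<subseteq> I" and K: "K \<subseteq> J"
  shows "embed J K et \<in> Leb K \<rightarrow>\<^sub>M V_borel J e et"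
proof -
  interpret V: Metric_space "V_space J et" "V_dist J e et"
    by (rule Metric_space_V[OF fc ss])
  \<comment> \<open>Points of \<open>Leb K\<close> carry coordinates only on \<open>K\<close>.
    Extension by zero maps them measurably into the Borel space of all sequences without changing
    the embedded function.\<close>
  define ext where "ext z i = (if i \<in> K then z i else 0)" for z :: "nat \<Rightarrow> real" and i
  have ext: "ext \<in> borel_measurable (Leb K)"
  proof (rule measurable_coordinatewise_then_product)
    fix i
    show "(\<lambda>z. ext z i) \<in> borel_measurable (Leb K)"
      unfolding ext_def by (cases "i \<in> K") auto
  qed
  have embed_ext: "embed J K et (ext z) = embed J K et z" for z
    unfolding embed_def ext_def by (intro HOL.ext sum.cong) auto
  have op: "open {z. embed J K et z \<in> U}" if U: "openin V.mtopology U" for U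
  proof (subst open_subopen, intro ballI)
    fix z0 assume "z0 \<in> {z. embed J K et z \<in> U}"
    then obtain r where r: "r > 0" "V.mball (embed J K et z0) r \<subseteq> U"
      using U unfolding V.openin_mtopology by blast
    define W where "W = {z. norm (\<Sum>i\<in>J. ((if i \<in> K then z i else 0) - (if i \<in> K then z0 i else 0)) *\<^sub>R e i) < r}"
    have c: "continuous_on UNIV (\<lambda>z::nat \<Rightarrow> real. if i \<in> K then z i else 0)" for i
      by (cases "i \<in> K") (auto intro: continuous_on_product_coordinates)
    have "open W"
      unfolding W_def by (intro open_Collect_less continuous_intros c)
    moreover have "z0 \<in> W" using r by (simp add: W_def)
    moreover have "W \<subseteq> {z. embed J K et z \<in> U}"
    proof
      fix z assume "z \<in> W"
      then have "V_dist J e et (embed J K et z) (embed J K et z0) < r"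
        unfolding W_def embed_def by (subst V_dist_combination[OF fc]) simp_all
      then have "embed J K et z \<in> V.mball (embed J K et z0) r"
        using V.commute[of "embed J K et z"] by (simp add: V.in_mball embed_in_V_space)
      then show "z \<in> {z. embed J K et z \<in> U}" using r by blast
    qed
    ultimately show "\<exists>T. open T \<and> z0 \<in> T \<and> T \<subseteq> {z. embed J K et z \<in> U}" by blast
  qed
  show ?thesis
    unfolding V_borel_def
  proof (rule measurable_measure_of)
    show "{U. openin V.mtopology U} \<subseteq> Pow (V_space J et)"
      using openin_subset[of V.mtopology] by auto
    show "embed J K et \<in> space (Leb K) \<rightarrow> V_space J et"
      by (simp add: embed_in_V_space)
    fix U assume "U \<in> {U. openin V.mtopology U}"
    then have "{z. embed J K et z \<in> U} \<in> sets borel" by (simp add: op)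
    then have "ext -` {z. embed J K et z \<in> U} \<inter> space (Leb K) \<in> sets (Leb K)"
      by (rule measurable_sets[OF ext])
    then show "embed J K et -` U \<inter> space (Leb K) \<in> sets (Leb K)"
      by (simp add: vimage_def embed_ext)
  qed
qed

section \<open>The lower bound\<close>

text \<open>Meant for the squared radius. The bound 1 keeps the points in the open unit ball; the
  bound 3/4 leaves 1/4, the square of the factor 1/2, once the cost has taken 1/2. The weight is not
  normalized, as its mass cancels.\<close>

definition shell :: "real \<Rightarrow> ennreal" where
  "shell r = indicator {3/4..<1} r"

lemma shell_measurable: "shell \<in> borel_measurable borel"
  unfolding shell_def[abs_def] by simp

text \<open>The shell contains the cube with sides \<open>{x..y}\<close> and lies in the cube with
  sides \<open>{-1..1}\<close>. Both bounds serve to cancel the mass in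
  \<open>ran_error_ge_singular_value\<close>.\<close>

lemma shell_mass:
  assumes K: "finite K" "K \<noteq> {}"
  shows "0 < (\<integral>\<^sup>+z. shell (sqnorm K z) \<partial>Leb K)" "(\<integral>\<^sup>+z. shell (sqnorm K z) \<partial>Leb K) < \<infinity>"
proof -
  define N where "N = real (card K)"
  have N: "N > 0" using K by (simp add: N_def card_gt_0_iff)
  \<comment> \<open>On the cube the squared norm runs from \<open>N * x^2 = 3/4\<close> to
    \<open>N * y^2 = 9/10\<close>; any number strictly between 3/4 and 1 could replace 9/10.\<close>
  define x where "x = sqrt (3 / (4 * N))"
  define y where "y = sqrt (9 / (10 * N))"
  have xy: "0 \<le> x" "x < y" "x\<^sup>2 = 3 / (4 * N)" "y\<^sup>2 = 9 / (10 * N)"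
    using N by (auto simp: x_def y_def divide_simps)
  have "0 < (\<Prod>k\<in>K. ennreal (y - x))"
    using xy by (simp add: ennreal_power)
  also have "\<dots> = (\<Prod>k\<in>K. emeasure lborel {x..y})"
    using xy by simp
  also have "\<dots> = emeasure (Leb K) (Pi\<^sub>E K (\<lambda>_. {x..y}))"
    using K by (intro Leb.emeasure_PiM[symmetric]) auto
  also have "\<dots> = (\<integral>\<^sup>+z. indicator (Pi\<^sub>E K (\<lambda>_. {x..y})) z \<partial>Leb K)"
    using K by (intro nn_integral_indicator[symmetric] sets_PiM_I_finite) auto
  also have "\<dots> \<le> (\<integral>\<^sup>+z. shell (sqnorm K z) \<partial>Leb K)"
  proof (intro nn_integral_mono)
    fix z
    have "sqnorm K z \<in> {3/4..<1}" if z: "z \<in> Pi\<^sub>E K (\<lambda>_. {x..y})"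
    proof -
      have zk: "x \<le> z k" "z k \<le> y" if "k \<in> K" for k using z that by (auto simp: PiE_def Pi_def)
      have "x\<^sup>2 \<le> (z k)\<^sup>2" "(z k)\<^sup>2 \<le> y\<^sup>2" if "k \<in> K" for k
        using zk[OF that] xy(1) by (auto intro!: power_mono)
      then have "(\<Sum>k\<in>K. x\<^sup>2) \<le> sqnorm K z" "sqnorm K z \<le> (\<Sum>k\<in>K. y\<^sup>2)"
        unfolding sqnorm_def by (intro sum_mono; blast)+
      then show ?thesis using N by (simp add: xy N_def[symmetric])
    qed
    then show "indicator (Pi\<^sub>E K (\<lambda>_. {x..y})) z \<le> shell (sqnorm K z)"
      by (auto simp: shell_def indicator_def)
  qed
  finally show "0 < (\<integral>\<^sup>+z. shell (sqnorm K z) \<partial>Leb K)" .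
  have "(\<integral>\<^sup>+z. shell (sqnorm K z) \<partial>Leb K) \<le> (\<integral>\<^sup>+z. indicator (Pi\<^sub>E K (\<lambda>_. {-1..1})) z \<partial>Leb K)"
  proof (intro nn_integral_mono)
    fix z assume z: "z \<in> space (Leb K)"
    have "z \<in> Pi\<^sub>E K (\<lambda>_. {-1..1})" if "sqnorm K z < 1"
    proof -
      have "\<bar>z k\<bar> \<le> 1" if "k \<in> K" for k
      proof -
        have "(z k)\<^sup>2 \<le> sqnorm K z"
          unfolding sqnorm_def using K that by (intro member_le_sum) auto
        then show ?thesis using \<open>sqnorm K z < 1\<close> by (simp add: abs_square_le_1[symmetric])
      qed
      then show ?thesis using z by (auto simp: space_PiM PiE_def Pi_def abs_le_iff)
    qed
    then show "shell (sqnorm K z) \<le> indicator (Pi\<^sub>E K (\<lambda>_. {-1..1})) z"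
      by (auto simp: shell_def indicator_def)
  qed
  also have "\<dots> = emeasure (Leb K) (Pi\<^sub>E K (\<lambda>_. {-1..1}))"
    using K by (intro nn_integral_indicator sets_PiM_I_finite) auto
  also have "\<dots> = (\<Prod>k\<in>K. emeasure lborel {-1..1::real})"
    using K by (intro Leb.emeasure_PiM) auto
  also have "\<dots> = ennreal (2 ^ card K)" by (simp add: ennreal_power[symmetric])
  also have "\<dots> < \<infinity>" by simp
  finally show "(\<integral>\<^sup>+z. shell (sqnorm K z) \<partial>Leb K) < \<infinity>" .
qed

text \<open>
  Differences of Borel functions need not be Borel in a nonseparable space, so the squared norm is
  expanded.
\<close>

lemma squared_distance_measurable:
  fixes T :: "'a \<Rightarrow> 'g::real_inner" and h :: "'a \<Rightarrow> 'g"
  assumes h: "h \<in> borel_measurable M" and a: "\<And>k. k \<in> K \<Longrightarrow> a k \<in> borel_measurable M"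
    and T: "\<And>p. T p = (\<Sum>k\<in>K. a k p *\<^sub>R v k)"
  shows "(\<lambda>p. (norm (T p - h p))\<^sup>2) \<in> borel_measurable M"
proof -
  have hk: "(\<lambda>p. v k \<bullet> h p) \<in> borel_measurable M" for k
    by (rule measurable_compose[OF h borel_measurable_continuous_onI]) (intro continuous_intros)
  have "(norm (T p - h p))\<^sup>2 = (\<Sum>j\<in>K. \<Sum>k\<in>K. a j p * (a k p * (v k \<bullet> v j)))
      - 2 * (\<Sum>k\<in>K. a k p * (v k \<bullet> h p)) + (norm (h p))\<^sup>2" for p
  proof -
    have "(norm (T p - h p))\<^sup>2 = T p \<bullet> T p - 2 * (T p \<bullet> h p) + (norm (h p))\<^sup>2"
      by (simp add: power2_norm_eq_inner inner_diff inner_commute)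
    then show ?thesis
      by (simp add: T inner_sum_left inner_sum_right sum_distrib_left)
  qed
  then show ?thesis
    using a hk h by (simp add: borel_measurable_sum)
qed

text \<open>For fixed \<open>\<omega>\<close> the algorithm is deterministic and
  \<open>adaptive_lower_bound\<close> applies; for fixed \<open>z\<close> in the ball the error and
  cost bounds apply. Fubini compares the two.\<close>

lemma ran_error_ge_singular_value:
  fixes S :: "'f::{real_inner, complete_space} \<Rightarrow> 'g::real_inner"
    and et :: "nat \<Rightarrow> 'd \<Rightarrow> real" and n :: nat
  assumes fc: "function_classes cls" "finite J" "\<forall>i\<in>J. et i \<in> cls (e i)"
    and S: "bounded_linear S" and ss: "singular_system S I \<sigma> e" "J \<subseteq> I"
    and n: "n \<ge> 1" "{1..4 * n} \<subseteq> J"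
    and alg: "randomized_algorithm J e et M q \<phi>" and cost: "ran_cost J e et M q \<le> of_nat n"
  shows "ennreal (\<sigma> (4 * n) / 2) \<le> ran_error S J e et M q \<phi>"
proof (cases "ran_error S J e et M q \<phi>")
  case (real \<epsilon>)
  define N where "N = 4 * n"
  define K where "K = {1..N}"
  define b where "b = (\<sigma> N)\<^sup>2"
  define U where "U = embed J K et"
  define T where "T z = S (\<Sum>k\<in>K. z k *\<^sub>R e k)" for z
  have K: "finite K" "K \<noteq> {}" "K \<subseteq> J" "K \<subseteq> I" "card K = N" "N > 0"
    using n ss(2) by (auto simp: K_def N_def)
  have \<sigma>: "0 \<le> \<sigma> N" using ss(1) K(6) unfolding singular_system_def by auto
  have b: "0 \<le> b" by (simp add: b_def)
  interpret S: bounded_linear S by (rule S)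
  interpret prob_space M using alg unfolding randomized_algorithm_def by blast
  interpret K: sigma_finite_measure "Leb K" by (rule Leb.sigma_finite[OF K(1)])
  interpret KM: pair_sigma_finite "Leb K" M ..
  have elem_U: "elem J e et (U z) = (\<Sum>k\<in>K. z k *\<^sub>R e k)" for z
    unfolding U_def by (rule elem_embed[OF fc K(3)])
  have T_elem: "S (elem J e et (U z)) = T z" for z by (simp add: elem_U T_def)
  have T_diff: "T z - T z' = S (\<Sum>k\<in>K. (z k - z' k) *\<^sub>R e k)" for z z'
    by (simp add: T_def S.diff[symmetric] sum_subtractf scaleR_left.diff)
  have T_expand: "b * (\<Sum>k\<in>K. (z k - z' k)\<^sup>2) \<le> (norm (T z - T z'))\<^sup>2" for z z'
    unfolding T_diff b_def K_def
    using norm_combination_ge[OF S ss(1), of N "\<lambda>k. z k - z' k"] K(4) by (simp add: K_def)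
  have ball: "U z \<in> V_ball J e et" if "sqnorm K z < 1" for z
  proof -
    have "elem J e et (U z) \<bullet> elem J e et (U z) = (\<Sum>k\<in>K. z k * ((\<Sum>j\<in>K. z j *\<^sub>R e j) \<bullet> e k))"
      unfolding elem_U by (subst inner_commute) (simp add: inner_sum_left inner_commute)
    also have "\<dots> = sqnorm K z"
      unfolding sqnorm_def
    proof (intro sum.cong refl)
      fix k assume k: "k \<in> K"
      have "(\<Sum>j\<in>K. z j *\<^sub>R e j) \<bullet> e k = z k"
        using inner_sum_singular_system[OF ss(1) K(1,4), of k z] k K(4) by auto
      then show "z k * ((\<Sum>j\<in>K. z j *\<^sub>R e j) \<bullet> e k) = (z k)\<^sup>2" by (simp add: power2_eq_square)
    qed
    finally have "norm (elem J e et (U z)) < 1"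
      using that by (simp add: norm_eq_sqrt_inner)
    then show ?thesis by (simp add: V_ball_def U_def embed_in_V_space)
  qed
  define E where "E z \<omega> = (norm (T z - \<phi> \<omega> (std_info (q \<omega>) (U z))))\<^sup>2" for z \<omega>
  define C where "C z \<omega> = real (num_values (q \<omega>) (U z))" for z \<omega>
  \<comment> \<open>Joint measurability in \<open>(u, \<omega>)\<close> is pulled back to
    \<open>(z, \<omega>)\<close>, as Fubini requires it.\<close>
  have U_meas: "(\<lambda>(z, \<omega>). (U z, \<omega>)) \<in> Leb K \<Otimes>\<^sub>M M \<rightarrow>\<^sub>M V_borel J e et \<Otimes>\<^sub>M M"
    unfolding U_def using embed_measurable[OF fc ss K(3)] by measurable
  have "(\<lambda>(u, \<omega>). num_values (q \<omega>) u) \<in> V_borel J e et \<Otimes>\<^sub>M M \<rightarrow>\<^sub>M count_space UNIV"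
    using alg unfolding randomized_algorithm_def by blast
  from measurable_compose[OF measurable_compose[OF U_meas this], of real borel]
  have C_meas: "(\<lambda>(z, \<omega>). C z \<omega>) \<in> borel_measurable (Leb K \<Otimes>\<^sub>M M)"
    by (simp add: C_def case_prod_unfold)
  have "(\<lambda>(u, \<omega>). \<phi> \<omega> (std_info (q \<omega>) u)) \<in> V_borel J e et \<Otimes>\<^sub>M M \<rightarrow>\<^sub>M borel"
    using alg unfolding randomized_algorithm_def by blast
  from measurable_compose[OF U_meas this]
  have "(\<lambda>p. \<phi> (snd p) (std_info (q (snd p)) (U (fst p)))) \<in> borel_measurable (Leb K \<Otimes>\<^sub>M M)"
    by (simp add: case_prod_unfold)
  from squared_distance_measurable[OF this, of K "\<lambda>k p. fst p k" "\<lambda>p. T (fst p)" "\<lambda>k. S (e k)"]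
  have E_meas: "(\<lambda>(z, \<omega>). E z \<omega>) \<in> borel_measurable (Leb K \<Otimes>\<^sub>M M)"
    unfolding E_def case_prod_unfold by (simp add: T_def S.sum S.scaleR measurable_compose[OF measurable_fst])
  define H where "H z \<omega> = ennreal (N * E z \<omega> + 2 * b * C z \<omega>)" for z \<omega>
  have shell_meas: "(\<lambda>z. shell (sqnorm K z)) \<in> borel_measurable (Leb K)"
    by (rule measurable_compose[OF measurable_sqnorm shell_measurable]) simp
  have "(\<lambda>p. shell (sqnorm K (fst p))) \<in> borel_measurable (Leb K \<Otimes>\<^sub>M M)"
    by (rule measurable_compose[OF measurable_fst shell_meas])
  then have H_meas: "(\<lambda>(z, \<omega>). shell (sqnorm K z) * H z \<omega>) \<in> borel_measurable (Leb K \<Otimes>\<^sub>M M)"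
    using E_meas C_meas
    unfolding H_def case_prod_unfold by simp
  have E_sec: "E z \<in> borel_measurable M" "C z \<in> borel_measurable M" if "z \<in> space (Leb K)" for z
    using measurable_Pair2[OF E_meas that] measurable_Pair2[OF C_meas that] by simp_all
  define m where "m = (\<integral>\<^sup>+z. shell (sqnorm K z) \<partial>Leb K)"
  have m: "0 < m" "m < \<infinity>" unfolding m_def by (rule shell_mass[OF K(1,2)])+
  have affine: "\<exists>\<alpha> \<beta>. \<forall>z. U z x = \<alpha> + (\<Sum>k\<in>K. \<beta> k * z k)" for x
  proof (intro exI allI)
    fix z
    show "U z x = 0 + (\<Sum>k\<in>K. et k x * z k)"
      unfolding U_def embed_eq[OF fc(2) K(3)] by simp
  qed
  have lower: "ennreal (b * N * (3 / 4)) * m \<le> (\<integral>\<^sup>+z. shell (sqnorm K z) * H z \<omega> \<partial>Leb K)"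
    if \<omega>: "\<omega> \<in> space M" for \<omega>
  proof -
    have meas: "(\<lambda>z. E z \<omega>) \<in> borel_measurable (Leb K)" "(\<lambda>z. C z \<omega>) \<in> borel_measurable (Leb K)"
      using measurable_Pair1[OF E_meas \<omega>] measurable_Pair1[OF C_meas \<omega>] by simp_all
    have term': "terminates (q \<omega>) (U z)" for z
      using alg \<omega> unfolding randomized_algorithm_def U_def by (simp add: embed_in_V_space)
    \<comment> \<open>On the support of the weight the squared norm is at least 3/4.\<close>
    have "ennreal (3 / 4) * m = (\<integral>\<^sup>+z. ennreal (3 / 4) * shell (sqnorm K z) \<partial>Leb K)"
      unfolding m_def using shell_meas by (intro nn_integral_cmult[symmetric])
    also have "\<dots> \<le> (\<integral>\<^sup>+z. shell (sqnorm K z) * ennreal (sqnorm K z) \<partial>Leb K)"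
      by (intro nn_integral_mono) (auto simp: shell_def indicator_def intro: ennreal_leI)
    finally have "ennreal (b * card K) * (ennreal (3 / 4) * m) \<le>
        ennreal (b * card K) * (\<integral>\<^sup>+z. shell (sqnorm K z) * ennreal (sqnorm K z) \<partial>Leb K)"
      by (rule mult_left_mono) simp
    also have "\<dots> \<le> (\<integral>\<^sup>+z. shell (sqnorm K z) *
        ennreal (N * (norm (T z - \<phi> \<omega> (std_info (q \<omega>) (U z))))\<^sup>2 + 2 * b * num_values (q \<omega>) (U z)) \<partial>Leb K)"
      using K(1,5) meas
      by (intro adaptive_lower_bound[OF _ _ shell_measurable _ b affine T_expand term'])
        (simp_all add: shell_def E_def C_def)
    also have "\<dots> = (\<integral>\<^sup>+z. shell (sqnorm K z) * H z \<omega> \<partial>Leb K)"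
      by (simp add: H_def E_def C_def)
    finally have "ennreal (b * card K) * ennreal (3 / 4) * m \<le> (\<integral>\<^sup>+z. shell (sqnorm K z) * H z \<omega> \<partial>Leb K)"
      by (simp only: mult.assoc)
    moreover have "ennreal (b * N * (3 / 4)) = ennreal (b * card K) * ennreal (3 / 4)"
      unfolding K(5) using b by (intro ennreal_mult) auto
    ultimately show ?thesis by (simp only:)
  qed
  \<comment> \<open>Restricted to the open unit ball, over which error and cost take their suprema;
    elsewhere the weight is 0.\<close>
  have upper: "(\<integral>\<^sup>+\<omega>. H z \<omega> \<partial>M) \<le> ennreal (N * \<epsilon>\<^sup>2 + 2 * b * n)"
    if z: "z \<in> space (Leb K)" "sqnorm K z < 1" for z
  proof -
    have "(\<integral>\<^sup>+\<omega>. of_nat (num_values (q \<omega>) (U z)) \<partial>M) \<le> ran_cost J e et M q"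
      unfolding ran_cost_def using ball[OF z(2)] by (intro SUP_upper)
    also note cost
    finally have C_le: "(\<integral>\<^sup>+\<omega>. ennreal (C z \<omega>) \<partial>M) \<le> ennreal n"
      by (simp add: C_def ennreal_of_nat_eq_real_of_nat)
    let ?X = "\<integral>\<^sup>+\<omega>. ennreal (E z \<omega>) \<partial>M"
    have "ennreal_sqrt ?X \<le> ran_error S J e et M q \<phi>"
      unfolding ran_error_def
      by (rule SUP_upper2[OF ball[OF z(2)]]) (simp add: T_elem E_def)
    then have le: "ennreal_sqrt ?X \<le> ennreal \<epsilon>" unfolding real .
    have E_le: "?X \<le> ennreal (\<epsilon>\<^sup>2)"
    proof (cases ?X)
      case (real x)
      then have "sqrt x \<le> \<epsilon>" using le \<open>0 \<le> \<epsilon>\<close> by (simp add: ennreal_sqrt_def)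
      then have "x \<le> \<epsilon>\<^sup>2" by (rule sqrt_le_D)
      then show ?thesis unfolding real by (rule ennreal_leI)
    next
      case top
      then show ?thesis using le by (simp add: ennreal_sqrt_def top_unique)
    qed
    have "(\<integral>\<^sup>+\<omega>. H z \<omega> \<partial>M) = (\<integral>\<^sup>+\<omega>. ennreal N * ennreal (E z \<omega>) + ennreal (2 * b) * ennreal (C z \<omega>) \<partial>M)"
      using b by (simp add: H_def E_def C_def ennreal_mult)
    also have "\<dots> = ennreal N * ?X + ennreal (2 * b) * (\<integral>\<^sup>+\<omega>. ennreal (C z \<omega>) \<partial>M)"
      using E_sec[OF z(1)] by (subst nn_integral_add) (simp_all add: nn_integral_cmult)
    also have "\<dots> \<le> ennreal N * ennreal (\<epsilon>\<^sup>2) + ennreal (2 * b) * ennreal n"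
      by (intro add_mono mult_left_mono E_le C_le) auto
    also have "\<dots> = ennreal (N * \<epsilon>\<^sup>2 + 2 * b * n)"
      using b by (simp add: ennreal_mult)
    finally show ?thesis .
  qed
  have "ennreal (b * N * (3 / 4)) * m = (\<integral>\<^sup>+\<omega>. ennreal (b * N * (3 / 4)) * m \<partial>M)"
    by (simp add: emeasure_space_1)
  also have "\<dots> \<le> (\<integral>\<^sup>+\<omega>. (\<integral>\<^sup>+z. shell (sqnorm K z) * H z \<omega> \<partial>Leb K) \<partial>M)"
    by (intro nn_integral_mono lower)
  also have "\<dots> = (\<integral>\<^sup>+z. (\<integral>\<^sup>+\<omega>. shell (sqnorm K z) * H z \<omega> \<partial>M) \<partial>Leb K)"
    by (rule KM.Fubini'[OF H_meas])
  also have "\<dots> \<le> (\<integral>\<^sup>+z. shell (sqnorm K z) * ennreal (N * \<epsilon>\<^sup>2 + 2 * b * n) \<partial>Leb K)"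
  proof (intro nn_integral_mono)
    fix z assume z: "z \<in> space (Leb K)"
    have "(\<integral>\<^sup>+\<omega>. shell (sqnorm K z) * H z \<omega> \<partial>M) = shell (sqnorm K z) * (\<integral>\<^sup>+\<omega>. H z \<omega> \<partial>M)"
      unfolding H_def using E_sec[OF z] by (intro nn_integral_cmult) simp
    also have "\<dots> \<le> shell (sqnorm K z) * ennreal (N * \<epsilon>\<^sup>2 + 2 * b * n)"
      using upper[OF z] by (cases "sqnorm K z < 1") (auto simp: shell_def intro!: mult_left_mono)
    finally show "(\<integral>\<^sup>+\<omega>. shell (sqnorm K z) * H z \<omega> \<partial>M) \<le> shell (sqnorm K z) * ennreal (N * \<epsilon>\<^sup>2 + 2 * b * n)" .
  qed
  also have "\<dots> = ennreal (N * \<epsilon>\<^sup>2 + 2 * b * n) * m"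
    unfolding m_def using shell_meas by (simp add: nn_integral_multc mult.commute)
  finally have "m * ennreal (b * N * (3 / 4)) \<le> m * ennreal (N * \<epsilon>\<^sup>2 + 2 * b * n)"
    by (simp only: mult.commute)
  then have "ennreal (b * N * (3 / 4)) \<le> ennreal (N * \<epsilon>\<^sup>2 + 2 * b * n)"
    by (subst (asm) ennreal_mult_le_mult_iff) (use m in auto)
  then have "b * N * (3 / 4) \<le> N * \<epsilon>\<^sup>2 + 2 * b * n"
    using b by (subst (asm) ennreal_le_iff) auto
  \<comment> \<open>With \<open>N = 4 * n\<close> the inequality reads
    \<open>3 * n * b \<le> 4 * n * \<epsilon>^2 + 2 * n * b\<close>.\<close>
  then have "real n * b \<le> real n * (4 * \<epsilon>\<^sup>2)"
    by (simp add: N_def algebra_simps)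
  then have "(\<sigma> N / 2)\<^sup>2 \<le> \<epsilon>\<^sup>2"
    using n(1) by (simp add: b_def power_divide)
  then have "\<sigma> N / 2 \<le> \<epsilon>" using \<open>0 \<le> \<epsilon>\<close> by (rule power2_le_imp_le)
  then show ?thesis unfolding real N_def by (rule ennreal_leI)
qed simp

theorem corollary2:
  fixes S :: "'f::{real_inner, complete_space} \<Rightarrow> 'g::{real_inner, complete_space}"
    and cls :: "'f \<Rightarrow> ('d \<Rightarrow> real) set"
    and I :: "nat set" and \<sigma> :: "nat \<Rightarrow> real" and e :: "nat \<Rightarrow> 'f"
    and et :: "nat \<Rightarrow> 'd \<Rightarrow> real" and n k :: nat
  assumes "function_classes cls"
    and "compact_operator S"
    and "singular_system S I \<sigma> e"
    and "n \<ge> 1" and "k \<ge> 3 * n"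
    and "\<And>i. i \<in> I \<inter> {1..n + k} \<Longrightarrow> et i \<in> cls (e i)"
  shows "e_std_ran TYPE('w) S (I \<inter> {1..n + k}) e et n \<ge> (1/2) * e_all_wor S (4 * n - 1)"
proof -
  have S: "bounded_linear S" using assms(2) by (simp add: compact_operator_def)
  define J where "J = I \<inter> {1..n + k}"
  have J: "finite J" "J \<subseteq> I" "\<forall>i\<in>J. et i \<in> cls (e i)"
    using assms(6) by (auto simp: J_def)
  have half: "(1/2 :: ennreal) = ennreal (1/2)"
    by (subst divide_ennreal[symmetric]) auto
  \<comment> \<open>\<open>n \<ge> 1\<close> makes \<open>4 * n\<close> the successor of
    \<open>4 * n - 1\<close>, so natural subtraction does not truncate.\<close>
  have "e_all_wor S (4 * n - 1) \<le> ennreal (\<sigma> (4 * n))"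
    using e_all_wor_le_singular_value[OF S assms(3), of "4 * n - 1"] assms(4) by simp
  then have "(1/2) * e_all_wor S (4 * n - 1) \<le> ennreal (1/2) * ennreal (\<sigma> (4 * n))"
    unfolding half by (rule mult_left_mono) simp
  also have "\<dots> = ennreal (\<sigma> (4 * n) / 2)"
    by (subst ennreal_mult'[symmetric]) auto
  also have "\<dots> \<le> e_std_ran TYPE('w) S J e et n"
    unfolding e_std_ran_def
  proof (rule INF_greatest, clarify)
    fix M :: "'w measure" and q and \<phi> :: "'w \<Rightarrow> real list \<Rightarrow> 'g"
    assume alg: "randomized_algorithm J e et M q \<phi>" "ran_cost J e et M q \<le> of_nat n"
    show "ennreal (\<sigma> (4 * n) / 2) \<le> ran_error S J e et M q \<phi>"
    \<comment> \<open>If \<open>4 * n\<close> is missing from \<open>I\<close>, the domain has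
      smaller dimension and the singular value is 0. Otherwise \<open>I\<close> contains
      \<open>{1..4 * n}\<close>, and \<open>k \<ge> 3 * n\<close> keeps all these indices in
      \<open>J\<close>.\<close>
    proof (cases "4 * n \<in> I")
      case True
      then have "{1..4 * n} \<subseteq> I" using assms(3) unfolding singular_system_def by auto
      then have "{1..4 * n} \<subseteq> J" using assms(5) by (auto simp: J_def)
      with J show ?thesis
        by (intro ran_error_ge_singular_value[OF assms(1) _ _ S assms(3) _ assms(4) _ alg])
    next
      case False
      then have "\<sigma> (4 * n) = 0" using assms(3,4) unfolding singular_system_def by auto
      then show ?thesis by simp
    qed
  qed
  finally show ?thesis unfolding J_def .
qed

end
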